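(* Let $(X_n)_{n\in\mathbb{N}}$ be the sequence of binary trees generated by the BST algorithm with input a sequence $(\eta_i)_{i\in\mathbb{N}}$ of independent random variables, each uniformly distributed on the unit interval $(0,1)$. (a) With probability 1 the sequence of probability measures $\mathrm{unif}(X_n)$ on $\bar{\mathbb{V}}$ converges weakly, as $n\to\infty$, to a random probability measure $X_\infty$ on $(\partial\mathbb{V},\mathcal{B}(\partial\mathbb{V}))$ (regarded as a probability measure on $\bar{\mathbb{V}}$ concentrated on $\partial\mathbb{V}$). (b) For each $u\in\mathbb{V}$ with $u\neq\varnothing$, let $\tau(u):=\inf\{n\in\mathbb{N}: u\in X_n\}$ and $i:=\tau(u)-1$, and let $$0=:\eta_{(i:0)}<\eta_{(i:1)}<\cdots<\eta_{(i:i)}<\eta_{(i:i+1)}:=1$$ be the augmented order statistics associated with $\eta_1,\ldots,\eta_i$. Then, almost surely, $$X_\infty(A_u)=\eta_{(i:j+1)}-\eta_{(i:j)},$$ where $j\in\{0,\ldots,i\}$ is determined by $\eta_{(i:j)}<\eta_{i+1}<\eta_{(i:j+1)}$. (c) The random variables $$\xi_u:=\frac{X_\infty(A_{u0})}{X_\infty(A_u)},\qquad u\in\mathbb{V},$$ are independent, and each $\xi_u$ is uniformly distributed on $(0,1)$.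
   Context: Nodes. $\mathbb{V}=\bigsqcup_{k\ge 0}\{0,1\}^k$ is the set of all finite 0--1 sequences (nodes), $\varnothing$ is the empty sequence, $|u|$ is the length of $u$, and $\partial\mathbb{V}=\{0,1\}^\infty$ is the set of infinite 0--1 sequences; $\bar{\mathbb{V}}=\mathbb{V}\cup\partial\mathbb{V}$. For $u=(u_1,\dots,u_k)\in\mathbb{V}$ write $u0=(u_1,\dots,u_k,0)$, $u1=(u_1,\dots,u_k,1)$, and, if $k\ge1$, $\bar u=(u_1,\dots,u_{k-1})$. Write $u\le v$ if $u$ is a prefix of $v$ ($v\in\bar{\mathbb{V}}$), and $u\wedge v$ for the longest common prefix of $u$ and $v$. Topology. $\mathbb{V}$ carries the metric $d_{\mathbb{V}}(u,v)=2^{-|u\wedge v|}-\frac12(2^{-|u|}+2^{-|v|})$; its completion is the compact separable metric space $\bar{\mathbb{V}}$ (with $2^{-|u|}:=0$ for $u\in\partial\mathbb{V}$). Weak convergence of probability measures refers to the metric space $(\bar{\mathbb{V}},d_{\mathbb{V}})$ with its Borel $\sigma$-field. $\mathcal{B}(\partial\mathbb{V})$ is the $\sigma$-field generated by the coordinate projections. For $u\in\mathbb{V}$, $A_u=\{v\in\partial\mathbb{V}: v\ge u\}$. For a finite nonempty $M\subset\mathbb{V}$, $\mathrm{unif}(M)$ is the uniform distribution on $M$, viewed as a probability measure on $\bar{\mathbb{V}}$. Binary trees. A binary tree is a prefix-stable set $x\subset\mathbb{V}$ ($u\in x$ and $v\le u$ imply $v\in x$). BST algorithm. For pairwise distinct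 reals $t_1,t_2,\dots$ it produces labeled binary trees $(x_n,L_n)$ with $\#x_n=n$ and $L_n:x_n\to\{t_1,\dots,t_n\}$: $x_1=\{\varnothing\}$, $L_1(\varnothing)=t_1$; given $(x_n,L_n)$, start at the root $\varnothing$, and at a current node $u\in x_n$ move to $u0$ if $t_{n+1}<L_n(u)$ and to $u1$ otherwise, until a node $u\notin x_n$ is reached; then $x_{n+1}=x_n\cup\{u\}$, $L_{n+1}(u)=t_{n+1}$, and $L_{n+1}=L_n$ on $x_n$. $X_n$ is the random tree $x_n$ obtained from $t_i=\eta_i$ (the $\eta_i$ are pairwise distinct with probability 1). The times $\tau(u)$ are almost surely finite. *)

theory Defs
  imports "HOL-Probability.Probability" "HOL-Library.Sublist" "HOL-Library.While_Combinator"
begin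

section \<open>Finite and infinite 0--1 sequences\<close>

text \<open>
  Finite nodes are lists of booleans (\<open>False\<close> is 0, \<open>True\<close> is 1), infinite 0--1 sequences are
  functions \<open>nat \<Rightarrow> bool\<close> whose coordinates are counted from 0. The type below is the disjoint
  union of the two.
\<close>

datatype vbar = Vertex "bool list" | End "nat \<Rightarrow> bool"

fun prefix_of :: "bool list \<Rightarrow> vbar \<Rightarrow> bool" where
  "prefix_of u (Vertex v) \<longleftrightarrow> prefix u v"
| "prefix_of u (End v) \<longleftrightarrow> u = map v [0..<length u]"

fun vlen :: "vbar \<Rightarrow> enat" where
  "vlen (Vertex u) = enat (length u)"
| "vlen (End v) = \<infinity>"

text \<open>The length of the longest common prefix; it is \<open>\<infinity>\<close> for two equal infinite sequences.\<close>

definition meet_len :: "vbar \<Rightarrow> vbar \<Rightarrow> enat" where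
  "meet_len u v = (SUP p\<in>{p. prefix_of p u \<and> prefix_of p v}. enat (length p))"

text \<open>\<open>weight n\<close> is \<open>2\<close> to the power \<open>-n\<close>, with value 0 at \<open>\<infinity>\<close>.\<close>

fun weight :: "enat \<Rightarrow> real" where
  "weight (enat n) = (1 / 2) ^ n"
| "weight \<infinity> = 0"

primrec coord :: "vbar \<Rightarrow> nat \<Rightarrow> bool" where
  "coord (Vertex u) = (\<lambda>k. u ! k)"
| "coord (End v) = v"

lemma prefix_of_iff:
  "prefix_of p u \<longleftrightarrow> enat (length p) \<le> vlen u \<and> p = map (coord u) [0..<length p]"
proof (cases u)
  case (Vertex v)
  have "prefix p v \<longleftrightarrow> length p \<le> length v \<and> p = take (length p) v"
    by (metis append_eq_conv_conj prefixE prefix_length_le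
        take_is_prefix)
  moreover have "take (length p) v = map ((!) v) [0..<length p]" if "length p \<le> length v"
    using that by (intro nth_equalityI) auto
  ultimately show ?thesis
    using Vertex by auto
qed auto

lemma prefix_of_map: "enat n \<le> vlen u \<Longrightarrow> prefix_of (map (coord u) [0..<n]) u"
  by (simp add: prefix_of_iff)

lemma prefix_of_take:
  assumes "prefix_of q u"
  shows "prefix_of (take n q) u"
proof (cases u)
  case (Vertex v)
  then show ?thesis
    using assms by (auto intro: prefix_order.trans[OF take_is_prefix])
next
  case (End v)
  then have "take n q = take n (map v [0..<length q])"
    using assms by simp
  then show ?thesis
    using End by (simp add: take_map take_upt min_def split: if_splits)
qed

lemma prefix_of_unique: "prefix_of p u \<Longrightarrow> prefix_of q u \<Longrightarrow> length p = length q \<Longrightarrow> p = q"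
  unfolding prefix_of_iff by argo

lemma enat_le_all: "(\<And>n. enat n \<le> a \<Longrightarrow> enat n \<le> b) \<Longrightarrow> a \<le> b"
  by (metis Suc_n_not_le_n enat.exhaust enat_ord_simps(1) enat_ord_simps(3) linear)

lemma vbar_eqI:
  assumes "\<And>p. prefix_of p u \<longleftrightarrow> prefix_of p v"
  shows "u = v"
proof -
  have len: "enat n \<le> vlen u \<longleftrightarrow> enat n \<le> vlen v" for n
    using assms[of "map (coord u) [0..<n]"] assms[of "map (coord v) [0..<n]"]
    by (auto simp: prefix_of_iff)
  have eq: "vlen u = vlen v"
    by (rule antisym; rule enat_le_all; simp only: len)
  have co: "coord u k = coord v k" if k: "enat (Suc k) \<le> vlen u" for k
  proof -
    have "map (coord u) [0..<Suc k] = map (coord v) [0..<Suc k]"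
      using k assms[of "map (coord u) [0..<Suc k]"] by (simp add: prefix_of_iff del: upt_Suc)
    then show ?thesis by simp
  qed
  show ?thesis
  proof (cases u; cases v)
    fix a b assume uv: "u = Vertex a" "v = Vertex b"
    show ?thesis
      using eq co unfolding uv by (auto intro!: nth_equalityI simp: Suc_le_eq)
  next
    fix a b assume uv: "u = End a" "v = End b"
    show ?thesis
      using co unfolding uv by auto
  qed (use eq in auto)
qed

lemma weight_nonneg: "0 \<le> weight n"
  by (cases n) auto

lemma weight_antimono: "m \<le> n \<Longrightarrow> weight n \<le> weight m"
  by (cases m; cases n) (auto intro!: power_decreasing)

lemma weight_strict: "m < n \<Longrightarrow> weight n < weight m"
  by (cases m; cases n) (auto intro: power_strict_decreasing)

lemma meet_len_commute: "meet_len u v = meet_len v u"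
  by (simp add: meet_len_def conj_commute)

lemma meet_len_le: "meet_len u v \<le> vlen u"
  by (auto simp: meet_len_def prefix_of_iff intro!: SUP_least)

lemma meet_len_ge_iff:
  "enat n \<le> meet_len u v \<longleftrightarrow> (\<exists>p. length p = n \<and> prefix_of p u \<and> prefix_of p v)"
proof
  assume *: "enat n \<le> meet_len u v"
  show "\<exists>p. length p = n \<and> prefix_of p u \<and> prefix_of p v"
  proof (cases n)
    case 0
    then show ?thesis
      by (intro exI[of _ "[]"]) (simp add: prefix_of_iff flip: zero_enat_def)
  next
    case (Suc m)
    have "enat m < meet_len u v"
      using * Suc by (metis enat_ord_simps(2) lessI less_le_trans)
    then obtain q where q: "prefix_of q u" "prefix_of q v" "m < length q"
      by (auto simp: meet_len_def less_SUP_iff)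
    then show ?thesis
      using Suc by (intro exI[of _ "take n q"]) (auto simp: prefix_of_take)
  qed
next
  assume "\<exists>p. length p = n \<and> prefix_of p u \<and> prefix_of p v"
  then show "enat n \<le> meet_len u v"
    by (auto simp: meet_len_def intro!: SUP_upper2)
qed

lemma meet_len_self: "meet_len u u = vlen u"
proof (rule antisym[OF meet_len_le enat_le_all])
  fix n assume "enat n \<le> vlen u"
  then show "enat n \<le> meet_len u u"
    unfolding meet_len_ge_iff using prefix_of_map[of n u]
    by (intro exI[of _ "map (coord u) [0..<n]"]) auto
qed

lemma meet_len_ultra: "min (meet_len u v) (meet_len v w) \<le> meet_len u w"
proof (rule enat_le_all)
  fix n assume "enat n \<le> min (meet_len u v) (meet_len v w)"
  then show "enat n \<le> meet_len u w"
    unfolding min.bounded_iff meet_len_ge_iff by (metis prefix_of_unique)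
qed

lemma meet_len_full:
  assumes "vlen u \<le> meet_len u v" "vlen v \<le> meet_len u v"
  shows "u = v"
proof (rule vbar_eqI)
  have *: "prefix_of p u \<and> prefix_of p v"
    if "enat (length p) \<le> meet_len u v" "prefix_of p u \<or> prefix_of p v" for p
    using that meet_len_ge_iff[of "length p" u v] by (metis prefix_of_unique)
  fix p
  show "prefix_of p u \<longleftrightarrow> prefix_of p v"
    using *[of p] assms prefix_of_iff[of p u] prefix_of_iff[of p v] order_trans by blast
qed

instantiation vbar :: metric_space
begin

definition dist_vbar :: "vbar \<Rightarrow> vbar \<Rightarrow> real" where
  "dist_vbar u v = weight (meet_len u v) - (weight (vlen u) + weight (vlen v)) / 2"

definition uniformity_vbar :: "(vbar \<times> vbar) filter" where
  "uniformity_vbar = (INF e\<in>{0<..}. principal {(x, y). dist x y < e})"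

definition open_vbar :: "vbar set \<Rightarrow> bool" where
  "open_vbar U \<longleftrightarrow> (\<forall>x\<in>U. eventually (\<lambda>(x', y). x' = x \<longrightarrow> y \<in> U) uniformity)"

instance
proof
  have w: "weight (vlen u) \<le> weight (meet_len u v)" for u v
    by (intro weight_antimono meet_len_le)
  have w': "weight (vlen v) \<le> weight (meet_len u v)" for u v
    using w[of v u] by (simp add: meet_len_commute)
  fix x y z :: vbar
  show "dist x y = 0 \<longleftrightarrow> x = y"
  proof
    assume "dist x y = 0"
    then have "weight (vlen x) = weight (meet_len x y)" "weight (vlen y) = weight (meet_len x y)"
      using w[of x y] w'[where u=x and v=y] unfolding dist_vbar_def by argo+
    then have "vlen x \<le> meet_len x y" "vlen y \<le> meet_len x y"
      using weight_strict by (metis less_irrefl not_le)+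
    then show "x = y" by (rule meet_len_full)
  qed (simp add: dist_vbar_def meet_len_self)
  have "weight (meet_len x y) \<le> weight (min (meet_len x z) (meet_len z y))"
    by (intro weight_antimono meet_len_ultra)
  then have "weight (meet_len x y) \<le> weight (meet_len x z) \<or>
      weight (meet_len x y) \<le> weight (meet_len z y)"
    by (auto simp: min_def split: if_splits)
  then show "dist x y \<le> dist x z + dist y z"
    using w'[where u=x and v=z] w[of z y] unfolding dist_vbar_def meet_len_commute[of y z] by argo
qed (simp_all add: uniformity_vbar_def open_vbar_def)

end


section \<open>Measures\<close>

text \<open>The infinite 0--1 sequences with the sigma-field generated by the coordinate projections.\<close>

definition boundary :: "(nat \<Rightarrow> bool) measure" where
  "boundary = (\<Pi>\<^sub>M k\<in>UNIV. count_space UNIV)"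

definition cyl :: "bool list \<Rightarrow> (nat \<Rightarrow> bool) set" where
  "cyl u = {v. prefix_of u (End v)}"

definition unif :: "bool list set \<Rightarrow> vbar measure" where
  "unif A = distr (uniform_count_measure A) borel Vertex"

definition on_vbar :: "(nat \<Rightarrow> bool) measure \<Rightarrow> vbar measure" where
  "on_vbar \<mu> = distr \<mu> borel End"

definition weakly_converges_to ::
  "(nat \<Rightarrow> 'a::metric_space measure) \<Rightarrow> 'a measure \<Rightarrow> bool" where
  "weakly_converges_to \<mu> \<nu> \<longleftrightarrow>
     (\<forall>f :: 'a \<Rightarrow> real. continuous_on UNIV f \<and> bounded (range f) \<longrightarrow>
        (\<lambda>n. \<integral>x. f x \<partial>\<mu> n) \<longlonglongrightarrow> (\<integral>x. f x \<partial>\<nu>))"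


section \<open>The BST algorithm\<close>

text \<open>
  A labeled binary tree is a partial function from nodes to labels; the tree itself is its domain.
  Inputs are indexed from 1. The empty map at time 0 is auxiliary: inserting the first label into
  it gives the root with this label.
\<close>

definition bst_position :: "real \<Rightarrow> (bool list \<rightharpoonup> real) \<Rightarrow> bool list" where
  "bst_position t L =
     while (\<lambda>u. u \<in> dom L) (\<lambda>u. if t < the (L u) then u @ [False] else u @ [True]) []"

primrec bst :: "(nat \<Rightarrow> real) \<Rightarrow> nat \<Rightarrow> (bool list \<rightharpoonup> real)" where
  "bst t 0 = Map.empty"
| "bst t (Suc n) = (bst t n)(bst_position (t (Suc n)) (bst t n) \<mapsto> t (Suc n))"

lemma bst_1: "bst t 1 = [[] \<mapsto> t 1]"
  by (simp add: bst_position_def while_unfold)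

definition bst_tree :: "(nat \<Rightarrow> real) \<Rightarrow> nat \<Rightarrow> bool list set" where
  "bst_tree t n = dom (bst t n)"

definition tau :: "(nat \<Rightarrow> real) \<Rightarrow> bool list \<Rightarrow> enat" where
  "tau t u = (INF n\<in>{n. n \<ge> 1 \<and> u \<in> bst_tree t n}. enat n)"

text \<open>The augmented order statistics of \<open>t 1, \<dots>, t i\<close>, for indices \<open>0, \<dots>, i + 1\<close>.\<close>

definition order_stat :: "(nat \<Rightarrow> real) \<Rightarrow> nat \<Rightarrow> nat \<Rightarrow> real" where
  "order_stat t i j = (0 # sort (map t [1..<Suc i]) @ [1]) ! j"

end

(*
  Let T(u) be the label of the node u in the infinite search tree and let I(u) be the half-open
  interval of all x in [0,1) whose search path passes through u, so that T(u) splits I(u) into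
  I(u0) and I(u1).  For every generic input (distinct values in (0,1) with uniform limiting
  frequencies) the fraction of nodes of X_n that extend u converges to the length of I(u), hence
  unif(X_n) converges to the distribution of the search path of a uniform random point.  When u
  is inserted, I(u) is a gap between neighbouring order statistics.  For independence, fix Borel
  sets B(u) for u in a finite set F of nodes, and let u contribute the indicator of "xi(u) in
  B(u)" if u is in X_n, and the uniform measure of B(u) otherwise.  The product over F is a
  bounded martingale, since a new input that falls into I(u) is uniform there; its limit is the
  indicator of "xi(u) in B(u) for all u in F", and its initial value is the product of the
  uniform measures of the B(u).
*)

theory Submission
  imports Defs
begin

section \<open>Search paths and their intervals\<close>

text \<open>The intervals whose frequencies are needed end at labels, that is at inputs, so a law of
  large numbers for a fixed interval does not apply to them. Hence the pathwise part assumes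
  limiting frequencies at all rational thresholds on one almost sure event and extends them to every
  real threshold by monotonicity; after that, everything up to the limit measure is deterministic.
  Frequencies also show that every node is eventually filled: an interval of positive length keeps
  receiving inputs. The limit has no mass at finite nodes because each level is finite while the
  tree grows. The product is a martingale because one insertion changes at most one factor: the new
  node is a prefix of no occupied node, so no existing ratio moves. Only equality of expectations is
  used, obtained by integrating out the last coordinate of a finite product space; no filtration
  appears. Each factor is frozen once its node is filled, so the products are eventually constant,
  and the value of their expectation gives both the independence and the uniform law.\<close>

primrec descent :: "(bool list \<Rightarrow> real) \<Rightarrow> real \<Rightarrow> nat \<Rightarrow> bool list" where
  "descent l x 0 = []"
| "descent l x (Suc k) = descent l x k @ [l (descent l x k) \<le> x]"

definition itinerary :: "(bool list \<Rightarrow> real) \<Rightarrow> real \<Rightarrow> nat \<Rightarrow> bool" where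
  "itinerary l x k \<longleftrightarrow> l (descent l x k) \<le> x"

text \<open>
  The truncation of all labels to the unit interval that is implicit in \<open>lo\<close> and \<open>hi\<close> makes
  \<open>descent_iff_interval\<close> hold without any assumption on the labelling.
\<close>

definition lo :: "(bool list \<Rightarrow> real) \<Rightarrow> bool list \<Rightarrow> real" where
  "lo l u = Max (insert 0 {l (take k u) |k. k < length u \<and> u ! k})"

definition hi :: "(bool list \<Rightarrow> real) \<Rightarrow> bool list \<Rightarrow> real" where
  "hi l u = Min (insert 1 {l (take k u) |k. k < length u \<and> \<not> u ! k})"

lemma length_descent [simp]: "length (descent l x k) = k"
  by (induction k) auto

lemma take_descent: "m \<le> k \<Longrightarrow> take m (descent l x k) = descent l x m"
  by (induction k) (auto simp: le_Suc_eq)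

lemma descent_eq_map: "descent l x k = map (itinerary l x) [0..<k]"
  by (induction k) (auto simp: itinerary_def)

lemma itinerary_in_cyl: "itinerary l x \<in> cyl u \<longleftrightarrow> u = descent l x (length u)"
  by (simp add: cyl_def descent_eq_map)

lemma descent_iff:
  "u = descent l x (length u) \<longleftrightarrow> (\<forall>k<length u. u ! k \<longleftrightarrow> l (take k u) \<le> x)"
proof (induction u rule: rev_induct)
  case (snoc b u)
  then show ?case
    by (auto simp: less_Suc_eq nth_append)
qed simp

lemma lo_in: "lo l u \<in> insert 0 {l (take k u) |k. k < length u \<and> u ! k}"
  unfolding lo_def by (intro Max_in) auto

lemma hi_in: "hi l u \<in> insert 1 {l (take k u) |k. k < length u \<and> \<not> u ! k}"
  unfolding hi_def by (intro Min_in) auto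

lemma lo_le_iff: "lo l u \<le> x \<longleftrightarrow> 0 \<le> x \<and> (\<forall>k<length u. u ! k \<longrightarrow> l (take k u) \<le> x)"
  unfolding lo_def by (subst Max_le_iff) auto

lemma less_hi_iff: "x < hi l u \<longleftrightarrow> x < 1 \<and> (\<forall>k<length u. \<not> u ! k \<longrightarrow> x < l (take k u))"
  unfolding hi_def by (subst Min_gr_iff) auto

lemma lo_nonneg: "0 \<le> lo l u"
  using lo_le_iff by blast

lemma hi_le_1: "hi l u \<le> 1"
  using less_hi_iff[of 1 l u] by auto

lemma descent_iff_interval:
  "0 \<le> x \<and> x < 1 \<and> u = descent l x (length u) \<longleftrightarrow> lo l u \<le> x \<and> x < hi l u"
  unfolding descent_iff lo_le_iff less_hi_iff by (auto simp: not_le)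

lemma lo_Nil [simp]: "lo l [] = 0" and hi_Nil [simp]: "hi l [] = 1"
  by (simp_all add: lo_def hi_def)

lemma lo_snoc: "lo l (u @ [b]) = (if b then max (lo l u) (l u) else lo l u)"
proof -
  \<comment> \<open>Reals with the same upper bounds coincide; \<open>lo_le_iff\<close> describes
    the upper bounds, so \<open>Max\<close> need not be unfolded.\<close>
  have "lo l (u @ [b]) \<le> x \<longleftrightarrow> (if b then max (lo l u) (l u) else lo l u) \<le> x" for x
    by (cases b) (auto simp: lo_le_iff All_less_Suc nth_append)
  from this[THEN iffD2, OF order_refl] this[THEN iffD1, OF order_refl] show ?thesis
    by (rule antisym)
qed

lemma hi_snoc: "hi l (u @ [b]) = (if b then hi l u else min (hi l u) (l u))"
proof -
  have "x < hi l (u @ [b]) \<longleftrightarrow> x < (if b then hi l u else min (hi l u) (l u))" for x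
    by (cases b) (auto simp: less_hi_iff All_less_Suc nth_append)
  from this[of "hi l (u @ [b])"] this[of "if b then hi l u else min (hi l u) (l u)"] show ?thesis
    by (simp split del: if_split)
qed

lemma lo_cong: "(\<And>k. k < length u \<Longrightarrow> l (take k u) = l' (take k u)) \<Longrightarrow> lo l u = lo l' u"
  unfolding lo_def by (rule arg_cong[where f = "\<lambda>A. Max (insert 0 A)"]) (force intro!: Collect_cong)

lemma hi_cong: "(\<And>k. k < length u \<Longrightarrow> l (take k u) = l' (take k u)) \<Longrightarrow> hi l u = hi l' u"
  unfolding hi_def by (rule arg_cong[where f = "\<lambda>A. Min (insert 1 A)"]) (force intro!: Collect_cong)

section \<open>The dynamics of the BST algorithm\<close>

text \<open>A search path has one node of each length, so it leaves a finite tree. The node returned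
  is the first one outside, and being first means that all proper prefixes are inside. This replaces
  the loop in all later arguments.\<close>

lemma bst_position_iff:
  assumes "finite (dom L)"
  shows "bst_position x L = v \<longleftrightarrow>
    v = descent (\<lambda>u. the (L u)) x (length v) \<and> v \<notin> dom L \<and> (\<forall>k<length v. take k v \<in> dom L)"
    (is "_ \<longleftrightarrow> ?P v")
proof -
  let ?d = "descent (\<lambda>u. the (L u)) x" and ?c = "\<lambda>u. if x < the (L u) then u @ [False] else u @ [True]"
  have iter: "(?c ^^ k) [] = ?d k" for k
    by (induction k) auto
  have ex: "\<exists>k. ?d k \<notin> dom L"
  proof (rule ccontr)
    assume "\<not> ?thesis"
    then have "range ?d \<subseteq> dom L"
      by auto
    moreover have "inj ?d"
      by (metis injI length_descent)
    ultimately show False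
      using assms finite_subset range_inj_infinite by blast
  qed
  define K where "K = (LEAST k. ?d k \<notin> dom L)"
  have K: "?d K \<notin> dom L" "\<And>k. k < K \<Longrightarrow> ?d k \<in> dom L"
    unfolding K_def using LeastI_ex[OF ex] not_less_Least by blast+
  \<comment> \<open>The loop returns the iterate at the least index at which its test fails, which
    is \<open>K\<close>.\<close>
  have pos: "bst_position x L = ?d K"
    using ex by (simp add: bst_position_def while_def while_option_def iter K_def)
  have "?P (?d K)"
    using K by (simp add: take_descent)
  moreover have "v = ?d K" if "?P v"
  proof -
    have "\<And>k. k < length v \<Longrightarrow> ?d k \<in> dom L"
      using that by (metis less_imp_le_nat take_descent)
    with K that have "length v = K"
      by (metis linorder_neqE_nat)
    with that show ?thesis by simp
  qed
  ultimately show ?thesis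
    using pos by auto
qed

section \<open>Growth of the tree and its labels\<close>

lemma finite_bst [simp]: "finite (dom (bst t n))"
  by (induction n) (simp_all del: fun_upd_apply)

text \<open>Counted from 0: \<open>node t n\<close> is the node that receives the label \<open>t (Suc n)\<close>.\<close>

definition node :: "(nat \<Rightarrow> real) \<Rightarrow> nat \<Rightarrow> bool list" where
  "node t n = bst_position (t (Suc n)) (bst t n)"

lemma bst_Suc: "bst t (Suc n) = (bst t n)(node t n \<mapsto> t (Suc n))"
  by (simp add: node_def)

lemma bst_tree_0 [simp]: "bst_tree t 0 = {}"
  by (simp add: bst_tree_def)

lemma bst_tree_Suc [simp]: "bst_tree t (Suc n) = insert (node t n) (bst_tree t n)"
  by (simp add: bst_tree_def node_def)

declare bst.simps(2) [simp del]

lemma bst_tree_eq: "bst_tree t n = node t ` {..<n}"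
  by (induction n) (auto simp: lessThan_Suc)

lemma node_notin: "node t n \<notin> bst_tree t n"
  and take_node: "k < length (node t n) \<Longrightarrow> take k (node t n) \<in> bst_tree t n"
  using bst_position_iff[of "bst t n" "t (Suc n)" "node t n"]
  by (simp_all add: node_def bst_tree_def)

lemma inj_node: "inj (node t)"
proof (rule linorder_injI)
  fix m n :: nat assume "m < n"
  then have "node t m \<in> bst_tree t n"
    by (auto simp: bst_tree_eq)
  then show "node t m \<noteq> node t n"
    using node_notin by metis
qed

lemma finite_bst_tree [simp]: "finite (bst_tree t n)"
  by (simp add: bst_tree_def)

lemma card_bst_tree: "card (bst_tree t n) = n"
  by (simp add: bst_tree_eq card_image inj_on_subset[OF inj_node])

lemma bst_tree_mono: "m \<le> n \<Longrightarrow> bst_tree t m \<subseteq> bst_tree t n"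
  by (auto simp: bst_tree_eq)

lemma bst_tree_take: "u \<in> bst_tree t n \<Longrightarrow> take k u \<in> bst_tree t n"
proof (induction n)
  case (Suc n)
  then show ?case
    by (cases "k < length (node t n)") (auto dest: take_node)
qed simp

lemma bst_eq_node:
  assumes "m < n"
  shows "bst t n (node t m) = Some (t (Suc m))"
  using assms
proof (induction n)
  case (Suc n)
  then show ?case
    using injD[OF inj_node, of t m n] by (auto simp: bst_Suc less_Suc_eq)
qed simp

text \<open>Labels are never overwritten, so the first time at which the node is present is as good
  as any later one (\<open>bst_label\<close>). A node that is never filled gets an unspecified
  value. Taking the time by \<open>LEAST\<close> makes it a random variable with countably many
  values, as used in \<open>measurable_label\<close>.\<close>

definition label :: "(nat \<Rightarrow> real) \<Rightarrow> bool list \<Rightarrow> real" where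
  "label t u = the (bst t (LEAST n. u \<in> bst_tree t n) u)"

lemma label_node [simp]: "label t (node t m) = t (Suc m)"
proof -
  have "node t m \<in> bst_tree t (LEAST n. node t m \<in> bst_tree t n)"
    by (rule LeastI[of _ "Suc m"]) simp
  then obtain m' where "m' < (LEAST n. node t m \<in> bst_tree t n)" "node t m = node t m'"
    by (auto simp: bst_tree_eq)
  then show ?thesis
    using injD[OF inj_node] unfolding label_def by (metis bst_eq_node option.sel)
qed

lemma bst_label: "u \<in> bst_tree t n \<Longrightarrow> the (bst t n u) = label t u"
  by (auto simp: bst_tree_eq bst_eq_node)

text \<open>A search reads labels only at proper prefixes of its final node. These are already in
  the tree, so the final labels of the infinite tree may be used instead of the current
  ones.\<close>

lemma node_iff:
  "node t n = v \<longleftrightarrow> v = descent (label t) (t (Suc n)) (length v) \<and> v \<notin> bst_tree t n \<and>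
     (\<forall>k<length v. take k v \<in> bst_tree t n)"
  unfolding node_def bst_position_iff[OF finite_bst] descent_iff bst_tree_def[symmetric]
  using bst_label by metis

lemma node_eq_descent: "node t n = descent (label t) (t (Suc n)) (length (node t n))"
  using node_iff by blast

text \<open>While all proper prefixes of \<open>w\<close> are occupied, a search that follows them
  cannot stop before \<open>w\<close>. So whether it ends at or below \<open>w\<close> is a
  condition on its path alone, hence an interval condition on the input.\<close>

lemma prefix_node_iff:
  assumes "\<And>k. k < length w \<Longrightarrow> take k w \<in> bst_tree t n"
  shows "prefix w (node t n) \<longleftrightarrow> w = descent (label t) (t (Suc n)) (length w)"
proof
  assume "prefix w (node t n)"
  then have "w = take (length w) (node t n)" "length w \<le> length (node t n)"
    by (metis append_eq_conv_conj prefixE, metis prefix_length_le)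
  then show "w = descent (label t) (t (Suc n)) (length w)"
    by (metis node_eq_descent take_descent)
next
  assume w: "w = descent (label t) (t (Suc n)) (length w)"
  have "length w \<le> length (node t n)"
  proof (rule ccontr)
    assume *: "\<not> ?thesis"
    then have "take (length (node t n)) w = node t n"
      by (metis w nat_le_linear node_eq_descent take_descent)
    with assms * node_notin show False
      by (metis not_le)
  qed
  then show "prefix w (node t n)"
    by (metis w node_eq_descent take_descent take_is_prefix)
qed

section \<open>Generic inputs\<close>

lemma relative_frequency_cong:
  assumes "\<forall>\<^sub>F i in sequentially. P i \<longleftrightarrow> Q i"
    and lim: "(\<lambda>n. real (card {i. i < n \<and> P i}) / real n) \<longlonglongrightarrow> c"
  shows "(\<lambda>n. real (card {i. i < n \<and> Q i}) / real n) \<longlonglongrightarrow> c"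
proof -
  obtain N where N: "\<And>i. i \<ge> N \<Longrightarrow> P i \<longleftrightarrow> Q i"
    using assms(1) by (auto simp: eventually_sequentially)
  have le: "card {i. i < n \<and> A i} \<le> card {i. i < n \<and> B i} + N"
    if "\<And>i. i \<ge> N \<Longrightarrow> A i \<longleftrightarrow> B i" for A B n
  proof -
    have "{i. i < n \<and> A i} \<subseteq> {i. i < n \<and> B i} \<union> {..<N}"
      using that by (auto simp: not_less)
    then have "card {i. i < n \<and> A i} \<le> card ({i. i < n \<and> B i} \<union> {..<N})"
      by (intro card_mono) auto
    also have "\<dots> \<le> card {i. i < n \<and> B i} + N"
      using card_Un_le[of "{i. i < n \<and> B i}" "{..<N}"] by simp
    finally show ?thesis .
  qed
  have "(\<lambda>n. real (card {i. i < n \<and> Q i}) / real n - real (card {i. i < n \<and> P i}) / real n)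
      \<longlonglongrightarrow> 0"
  proof (rule Lim_null_comparison)
    show "\<forall>\<^sub>F n in sequentially. norm (real (card {i. i < n \<and> Q i}) / real n -
        real (card {i. i < n \<and> P i}) / real n) \<le> real N / real n"
    proof (rule always_eventually, rule allI)
      fix n
      have "\<bar>real (card {i. i < n \<and> Q i}) - real (card {i. i < n \<and> P i})\<bar> \<le> real N"
        using le[of P Q n] le[of Q P n] N by (simp add: abs_le_iff)
      then show "norm (real (card {i. i < n \<and> Q i}) / real n -
          real (card {i. i < n \<and> P i}) / real n) \<le> real N / real n"
        by (simp add: divide_right_mono flip: diff_divide_distrib)
    qed
    show "(\<lambda>n. real N / real n) \<longlonglongrightarrow> 0"
      by (rule lim_const_over_n)
  qed
  from tendsto_add[OF lim this] show ?thesis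
    by simp
qed

lemma sorted_consecutive:
  fixes xs :: "'a::linorder list"
  assumes xs: "sorted_wrt (<) xs" and "a \<in> set xs" "b \<in> set xs" "a < b"
    and gap: "\<And>z. z \<in> set xs \<Longrightarrow> \<not> (a < z \<and> z < b)"
  obtains j where "Suc j < length xs" "xs ! j = a" "xs ! Suc j = b"
proof -
  obtain j k where j: "j < length xs" "xs ! j = a" and k: "k < length xs" "xs ! k = b"
    using assms by (metis in_set_conv_nth)
  have "j < k"
    using j k \<open>a < b\<close> sorted_wrt_nth_less[OF xs, of k j] by (metis less_asym linorder_neqE_nat)
  moreover have "\<not> Suc j < k"
    using j k gap[of "xs ! Suc j"] sorted_wrt_nth_less[OF xs, of j "Suc j"]
      sorted_wrt_nth_less[OF xs, of "Suc j" k] by auto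
  ultimately have "k = Suc j"
    by simp
  with that j k show ?thesis by metis
qed

text \<open>The properties of a single input sequence on which the pathwise part rests. Frequencies
  are required at rational thresholds so that the whole list is a countable intersection of almost
  sure events.\<close>

locale generic_input =
  fixes t :: "nat \<Rightarrow> real"
  assumes pos: "\<And>i. 0 < t (Suc i)" and less_1: "\<And>i. t (Suc i) < 1"
    and inj: "inj (\<lambda>i. t (Suc i))"
    and freq_Rats: "\<And>q. q \<in> \<rat> \<Longrightarrow> 0 < q \<Longrightarrow> q < 1 \<Longrightarrow>
      (\<lambda>n. real (card {i. i < n \<and> t (Suc i) < q}) / real n) \<longlonglongrightarrow> q"
begin

text \<open>Squeezing between rational thresholds. For one fixed input this covers every real
  \<open>x\<close>, in particular the labels of that very input.\<close>

lemma freq_less: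
  assumes "0 \<le> x" "x \<le> 1"
  shows "(\<lambda>n. real (card {i. i < n \<and> t (Suc i) < x}) / real n) \<longlonglongrightarrow> x"
proof -
  have mono: "real (card {i. i < n \<and> t (Suc i) < x}) / real n
      \<le> real (card {i. i < n \<and> t (Suc i) < y}) / real n" if "x \<le> y" for x y n
    using that by (intro divide_right_mono of_nat_mono card_mono) auto
  consider "x = 0" | "x = 1" | "0 < x" "x < 1"
    using assms by linarith
  then show ?thesis
  proof cases
    assume "x = 0"
    then have none: "{i. i < n \<and> t (Suc i) < x} = {}" for n
      using pos by (auto simp: not_less less_imp_le)
    show ?thesis
      unfolding none using \<open>x = 0\<close> by simp
  next
    assume "x = 1"
    then have "{i. i < n \<and> t (Suc i) < x} = {..<n}" for n
      using less_1 by auto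
    then have "\<forall>\<^sub>F n in sequentially. real (card {i. i < n \<and> t (Suc i) < x}) / real n = x"
      using \<open>x = 1\<close> eventually_gt_at_top[of 0] by (auto elim!: eventually_mono)
    then show ?thesis
      by (rule tendsto_eventually)
  next
    assume x: "0 < x" "x < 1"
    show ?thesis
    proof (rule order_tendstoI)
      fix a assume "a < x"
      then obtain q where q: "q \<in> \<rat>" "max 0 a < q" "q < x"
        using Rats_dense_in_real[of "max 0 a" x] x by auto
      have "\<forall>\<^sub>F n in sequentially. a < real (card {i. i < n \<and> t (Suc i) < q}) / real n"
        using q x by (intro order_tendstoD(1)[OF freq_Rats]) auto
      then show "\<forall>\<^sub>F n in sequentially. a < real (card {i. i < n \<and> t (Suc i) < x}) / real n"
        by (rule eventually_mono) (rule less_le_trans[OF _ mono[OF less_imp_le[OF q(3)]]])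
    next
      fix a assume "x < a"
      then obtain q where q: "q \<in> \<rat>" "x < q" "q < min 1 a"
        using Rats_dense_in_real[of x "min 1 a"] x by auto
      have "\<forall>\<^sub>F n in sequentially. real (card {i. i < n \<and> t (Suc i) < q}) / real n < a"
        using q x by (intro order_tendstoD(2)[OF freq_Rats]) auto
      then show "\<forall>\<^sub>F n in sequentially. real (card {i. i < n \<and> t (Suc i) < x}) / real n < a"
        by (rule eventually_mono) (rule le_less_trans[OF mono[OF less_imp_le[OF q(2)]]])
    qed
  qed
qed

lemma freq_interval:
  assumes "0 \<le> a" "a \<le> b" "b \<le> 1"
  shows "(\<lambda>n. real (card {i. i < n \<and> a \<le> t (Suc i) \<and> t (Suc i) < b}) / real n) \<longlonglongrightarrow> b - a"
proof -
  have "real (card {i. i < n \<and> a \<le> t (Suc i) \<and> t (Suc i) < b}) =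
      real (card {i. i < n \<and> t (Suc i) < b}) - real (card {i. i < n \<and> t (Suc i) < a})" for n
  proof -
    have "card ({i. i < n \<and> a \<le> t (Suc i) \<and> t (Suc i) < b} \<union> {i. i < n \<and> t (Suc i) < a}) =
        card {i. i < n \<and> a \<le> t (Suc i) \<and> t (Suc i) < b} + card {i. i < n \<and> t (Suc i) < a}"
      by (rule card_Un_disjoint) auto
    moreover have "{i. i < n \<and> a \<le> t (Suc i) \<and> t (Suc i) < b} \<union> {i. i < n \<and> t (Suc i) < a} =
        {i. i < n \<and> t (Suc i) < b}"
      using assms by auto
    ultimately show ?thesis by simp
  qed
  then show ?thesis
    using tendsto_diff[OF freq_less[of b] freq_less[of a]] assms
    by (simp add: diff_divide_distrib)
qed

abbreviation "l \<equiv> label t"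

lemma descent_input: "w = descent l (t (Suc i)) (length w) \<longleftrightarrow> lo l w \<le> t (Suc i) \<and> t (Suc i) < hi l w"
  using descent_iff_interval[of "t (Suc i)" w l] pos[of i] less_1[of i] by auto

text \<open>Both hypotheses hold for every \<open>w\<close>, but this is a consequence of
  \<open>interval_filled\<close>, whose induction applies the present lemma to a node for which they
  have just been established.\<close>

lemma prefix_node_freq:
  assumes "lo l w \<le> hi l w" "\<And>k. k < length w \<Longrightarrow> take k w \<in> bst_tree t N"
  shows "(\<lambda>n. real (card {i. i < n \<and> prefix w (node t i)}) / real n) \<longlonglongrightarrow> hi l w - lo l w"
proof (rule relative_frequency_cong)
  show "\<forall>\<^sub>F i in sequentially. lo l w \<le> t (Suc i) \<and> t (Suc i) < hi l w \<longleftrightarrow> prefix w (node t i)"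
    using eventually_ge_at_top[of N]
  proof eventually_elim
    fix i assume "N \<le> i"
    then have "\<And>k. k < length w \<Longrightarrow> take k w \<in> bst_tree t i"
      using assms bst_tree_mono by blast
    then show "lo l w \<le> t (Suc i) \<and> t (Suc i) < hi l w \<longleftrightarrow> prefix w (node t i)"
      by (simp add: prefix_node_iff flip: descent_input)
  qed
qed (intro freq_interval lo_nonneg hi_le_1 assms)

text \<open>The search path only gives the half-open interval. Its left end is 0 or the label of a
  proper prefix, which is an earlier input, so positivity and distinctness make the inequality
  strict.\<close>

lemma label_in_interval:
  "lo l (node t m) < t (Suc m)" "t (Suc m) < hi l (node t m)"
proof -
  have in_int: "lo l (node t m) \<le> t (Suc m) \<and> t (Suc m) < hi l (node t m)"
    using node_eq_descent descent_input by blast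
  have "lo l (node t m) \<noteq> t (Suc m)"
  proof (cases "lo l (node t m) = 0")
    case True
    then show ?thesis using pos[of m] by simp
  next
    case False
    then obtain k where k: "k < length (node t m)" "lo l (node t m) = l (take k (node t m))"
      using lo_in[of l "node t m"] by auto
    then obtain m' where "m' < m" "take k (node t m) = node t m'"
      using take_node[of k t m] by (auto simp: bst_tree_eq)
    then show ?thesis
      using k injD[OF inj, of m' m] by auto
  qed
  with in_int show "lo l (node t m) < t (Suc m)" "t (Suc m) < hi l (node t m)"
    by auto
qed

text \<open>The two claims need each other. A filled node has its label strictly inside its
  interval, so both children have intervals of positive length. These receive a positive fraction of
  the inputs, so some search ends at or below each child, and prefix stability puts the child itself
  into the tree.\<close>

lemma interval_filled:
  "lo l u < hi l u \<and> (\<exists>m. node t m = u)"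
proof (induction u rule: rev_induct)
  case Nil
  have "node t 0 = []"
    by (simp add: node_iff)
  then show ?case by auto
next
  case (snoc b u)
  then obtain m where m: "node t m = u"
    by blast
  have less: "lo l (u @ [b]) < hi l (u @ [b])"
    using label_in_interval[of m] m by (auto simp: lo_snoc hi_snoc min_def max_def)
  have "take k (u @ [b]) \<in> bst_tree t (Suc m)" if "k < length (u @ [b])" for k
    using that m bst_tree_take[of u t "Suc m" k] by (simp add: less_Suc_eq_le)
  from prefix_node_freq[OF less_imp_le[OF less] this]
  have lim: "(\<lambda>n. real (card {i. i < n \<and> prefix (u @ [b]) (node t i)}) / real n)
      \<longlonglongrightarrow> hi l (u @ [b]) - lo l (u @ [b])" .
  have "\<exists>i. prefix (u @ [b]) (node t i)"
  proof (rule ccontr)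
    assume "\<not> ?thesis"
    with lim have "(\<lambda>n. 0) \<longlonglongrightarrow> hi l (u @ [b]) - lo l (u @ [b])"
      by simp
    with less show False
      using LIMSEQ_unique[OF _ tendsto_const[of 0]] by fastforce
  qed
  then obtain i where "prefix (u @ [b]) (node t i)" ..
  then have "u @ [b] = take (length (u @ [b])) (node t i)"
    by (metis append_eq_conv_conj prefixE)
  moreover have "node t i \<in> bst_tree t (Suc i)"
    by simp
  ultimately have "u @ [b] \<in> bst_tree t (Suc i)"
    using bst_tree_take by metis
  with less show ?case
    by (auto simp: bst_tree_eq)
qed

lemma lo_less_hi: "lo l u < hi l u"
  using interval_filled by blast

lemma node_surj: obtains m where "node t m = u"
  using interval_filled by blast

lemma label_between: "lo l u < l u" "l u < hi l u"
  using label_in_interval by (metis label_node node_surj)+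

lemma prefixes_in_tree: "\<exists>n. \<forall>k<length w. take k w \<in> bst_tree t n"
proof -
  obtain m where "node t m = w"
    by (rule node_surj)
  then show ?thesis
    using take_node by blast
qed

lemma tree_prefix_freq:
  "(\<lambda>n. real (card {v \<in> bst_tree t n. prefix w v}) / real n) \<longlonglongrightarrow> hi l w - lo l w"
proof -
  have "{v \<in> bst_tree t n. prefix w v} = node t ` {i. i < n \<and> prefix w (node t i)}" for n
    by (auto simp: bst_tree_eq)
  then have "card {v \<in> bst_tree t n. prefix w v} = card {i. i < n \<and> prefix w (node t i)}" for n
    by (simp add: card_image inj_on_subset[OF inj_node])
  then show ?thesis
    using prefixes_in_tree prefix_node_freq[OF less_imp_le[OF lo_less_hi]] by fastforce
qed

section \<open>Insertion times and order statistics\<close>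

lemma tau_node: "tau t (node t m) = enat (Suc m)"
proof -
  have iff: "node t m \<in> bst_tree t n \<longleftrightarrow> m < n" for n
    using injD[OF inj_node] by (auto simp: bst_tree_eq)
  show ?thesis
    unfolding tau_def iff
    by (intro antisym INF_lower2[of "Suc m"] INF_greatest) auto
qed

text \<open>If the earlier label lay inside the interval, its infinite path would pass through
  \<open>node t m\<close>, which is still free at that time; so its search stopped at a proper
  prefix of that node. The path turns right there, which bounds the label by the left end of the
  interval.\<close>

lemma no_label_between:
  assumes "m' < m"
  shows "\<not> (lo l (node t m) < t (Suc m') \<and> t (Suc m') < hi l (node t m))"
proof
  let ?u = "node t m" and ?p = "node t m'"
  assume between: "lo l ?u < t (Suc m') \<and> t (Suc m') < hi l ?u"
  then have u: "?u = descent l (t (Suc m')) (length ?u)"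
    by (simp add: descent_input)
  have "length ?p < length ?u"
  proof (rule ccontr)
    assume "\<not> ?thesis"
    then have "?u = take (length ?u) ?p"
      using u node_eq_descent[of t m'] by (metis not_less take_descent)
    moreover have "?p \<in> bst_tree t m"
      using assms by (auto simp: bst_tree_eq)
    ultimately show False
      using node_notin bst_tree_take by metis
  qed
  moreover from this have "take (length ?p) ?u = ?p"
    using u node_eq_descent[of t m'] by (metis less_imp_le take_descent)
  \<comment> \<open>The path of the label of \<open>?p\<close> compares this label with itself at
    \<open>?p\<close>, and ties go right.\<close>
  moreover from calculation have "?u ! length ?p"
    using u descent_iff by (metis label_node order_refl)
  ultimately have "t (Suc m') \<le> lo l ?u"
    using lo_le_iff[of l ?u "lo l ?u"] by (metis label_node order_refl)
  with between show False by simp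
qed

text \<open>Both ends of the interval are 0, 1 or labels of proper prefixes, hence entries of the
  augmented list, and \<open>no_label_between\<close> makes them neighbours. The node is filled at
  time \<open>m + 1\<close>, so \<open>m\<close> is the index i of part (b).\<close>

lemma order_stat_gap:
  fixes m
  defines "s \<equiv> order_stat t m"
  shows "strict_mono_on {0..m + 1} s"
    and "\<exists>j\<in>{0..m}. (\<forall>k\<in>{0..m}. s k < t (m + 1) \<and> t (m + 1) < s (k + 1) \<longleftrightarrow> k = j) \<and>
      hi l (node t m) - lo l (node t m) = s (j + 1) - s j"
proof -
  let ?u = "node t m"
  define xs where "xs = 0 # sort (map t [1..<Suc m]) @ [1]"
  have s: "s j = xs ! j" for j
    by (simp add: s_def order_stat_def xs_def)
  have len: "length xs = m + 2"
    by (simp add: xs_def)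
  have "set [1..<Suc m] = Suc ` {..<m}"
    by (simp only: set_upt image_Suc_lessThan) auto
  then have "set (sort (map t [1..<Suc m])) = (\<lambda>i. t (Suc i)) ` {..<m}"
    by (simp only: set_sort set_map image_image)
  then have set_xs: "set xs = {0, 1} \<union> (\<lambda>i. t (Suc i)) ` {..<m}"
    by (simp only: xs_def set_append list.set) blast
  have "distinct (map t [1..<Suc m])"
    unfolding distinct_map
  proof (intro conjI inj_onI)
    fix x y assume "x \<in> set [1..<Suc m]" "y \<in> set [1..<Suc m]" "t x = t y"
    then show "x = y"
      using injD[OF inj, of "x - 1" "y - 1"] by auto
  qed simp
  moreover have "0 < x \<and> x < 1" if "x \<in> set (map t [1..<Suc m])" for x
    using that pos less_1 by (auto simp: Suc_le_eq) (metis Suc_pred)+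
  ultimately have sorted: "sorted_wrt (<) xs"
    by (fastforce simp: xs_def sorted_wrt_append strict_sorted_iff)
  have nth_less: "s j < s k" if "j < k" "k \<le> m + 1" for j k
    using sorted_wrt_nth_less[OF sorted, of j k] that by (simp add: s len)
  then show "strict_mono_on {0..m + 1} s"
    by (auto intro!: strict_mono_onI)
  have labels: "l (take k ?u) \<in> (\<lambda>i. t (Suc i)) ` {..<m}" if "k < length ?u" for k
    using take_node[OF that] by (auto simp: bst_tree_eq)
  have "lo l ?u \<in> set xs" "hi l ?u \<in> set xs"
    using lo_in[of l ?u] hi_in[of l ?u] labels unfolding set_xs by auto
  moreover have "\<not> (lo l ?u < z \<and> z < hi l ?u)" if "z \<in> set xs" for z
    using that no_label_between[of _ m] lo_nonneg[of l ?u] hi_le_1[of l ?u]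
    unfolding set_xs by auto
  ultimately obtain j where j: "Suc j < length xs" "xs ! j = lo l ?u" "xs ! Suc j = hi l ?u"
    using sorted_consecutive[OF sorted _ _ lo_less_hi] by blast
  have between: "s j < t (m + 1)" "t (m + 1) < s (j + 1)"
    using label_in_interval[of m] j by (simp_all add: s)
  have "k = j" if "k \<in> {0..m}" "s k < t (m + 1)" "t (m + 1) < s (k + 1)" for k
  proof (rule linorder_cases)
    assume "k < j"
    then have "s (k + 1) \<le> s j"
      using nth_less[of "k + 1" j] j len by (cases "k + 1 = j") auto
    with that between show ?thesis by simp
  next
    assume "j < k"
    then have "s (j + 1) \<le> s k"
      using nth_less[of "j + 1" k] that by (cases "j + 1 = k") auto
    with that between show ?thesis by simp
  qed
  with between j len show "\<exists>j\<in>{0..m}. (\<forall>k\<in>{0..m}. s k < t (m + 1) \<and> t (m + 1) < s (k + 1) \<longleftrightarrow> k = j) \<and>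
      hi l (node t m) - lo l (node t m) = s (j + 1) - s j"
    by (intro bexI[of _ j]) (auto simp: s)
qed

end

section \<open>Weak convergence\<close>

lemma space_boundary [simp]: "space boundary = UNIV"
  by (simp add: boundary_def space_PiM)

lemma measurable_boundary_coord [measurable]: "(\<lambda>v. v k) \<in> boundary \<rightarrow>\<^sub>M count_space UNIV"
  unfolding boundary_def by (rule measurable_component_singleton) simp

lemma cyl_iff: "v \<in> cyl u \<longleftrightarrow> (\<forall>k<length u. v k \<longleftrightarrow> u ! k)"
  unfolding cyl_def mem_Collect_eq prefix_of.simps list_eq_iff_nth_eq[of u] by auto

lemma sets_cyl [measurable]: "cyl u \<in> sets boundary"
proof -
  have "cyl u = {v \<in> space boundary. \<forall>k<length u. v k \<longleftrightarrow> u ! k}"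
    by (auto simp: cyl_iff)
  also have "\<dots> \<in> sets boundary"
    by measurable
  finally show ?thesis .
qed

lemma prefix_of_prefix: "prefix q p \<Longrightarrow> prefix_of p x \<Longrightarrow> prefix_of q x"
  by (metis append_eq_conv_conj prefixE prefix_of_take)

lemma dist_End_le:
  assumes "prefix_of (map v [0..<n]) x"
  shows "dist x (End v) \<le> (1 / 2) ^ n"
proof -
  have "enat n \<le> meet_len x (End v)"
    unfolding meet_len_ge_iff using assms by (intro exI[of _ "map v [0..<n]"]) simp
  from weight_antimono[OF this] show ?thesis
    using weight_nonneg[of "vlen x"] by (simp add: dist_vbar_def)
qed

lemma half_power_less:
  assumes "0 < d"
  obtains n where "(1 / 2 :: real) ^ n < d"
  using assms real_arch_pow_inv[of d "1 / 2"] by auto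

text \<open>An open set pulled back to the ends is the union of the cylinders that it contains, and
  there are only countably many cylinders.\<close>

lemma measurable_End [measurable]: "End \<in> boundary \<rightarrow>\<^sub>M borel"
proof (rule borel_measurableI)
  fix S :: "vbar set" assume "open S"
  have "End -` S = (\<Union>u\<in>{u. cyl u \<subseteq> End -` S}. cyl u)"
  proof (intro equalityI subsetI)
    fix v assume "v \<in> End -` S"
    then obtain d where d: "0 < d" "\<And>x. dist x (End v) < d \<Longrightarrow> x \<in> S"
      using \<open>open S\<close> unfolding open_dist by auto
    obtain n where n: "(1 / 2) ^ n < d"
      using half_power_less[OF d(1)] .
    have "cyl (map v [0..<n]) \<subseteq> End -` S"
    proof
      fix w assume "w \<in> cyl (map v [0..<n])"
      then have "dist (End w) (End v) \<le> (1 / 2) ^ n"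
        by (intro dist_End_le) (simp add: cyl_def)
      with n d show "w \<in> End -` S" by simp
    qed
    moreover have "v \<in> cyl (map v [0..<n])"
      by (simp add: cyl_iff)
    ultimately show "v \<in> (\<Union>u\<in>{u. cyl u \<subseteq> End -` S}. cyl u)"
      by blast
  qed blast
  also have "\<dots> \<in> sets boundary"
    by (intro sets.countable_UN'') auto
  finally show "End -` S \<inter> space boundary \<in> sets boundary"
    by simp
qed

text \<open>
  Koenig's lemma: if the oscillation over some subtree of every level were at least \<open>e\<close>, then
  always descending into such a subtree would lead to an end where \<open>f\<close> is discontinuous.
\<close>

lemma oscillation_small:
  fixes f :: "vbar \<Rightarrow> real"
  assumes f: "continuous_on UNIV f" and e: "0 < e"
  shows "\<exists>k. \<forall>w x y. length w = k \<longrightarrow> prefix_of w x \<longrightarrow> prefix_of w y \<longrightarrow> \<bar>f x - f y\<bar> < e"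
proof -
  define good where "good w k \<longleftrightarrow>
    (\<forall>z x y. length z \<ge> k \<longrightarrow> prefix_of (w @ z) x \<longrightarrow> prefix_of (w @ z) y \<longrightarrow> \<bar>f x - f y\<bar> < e)"
    for w k
  have good_mono: "good w k \<Longrightarrow> k \<le> k' \<Longrightarrow> good w k'" for w k k'
    unfolding good_def by (meson order_trans)
  have step: "good w (Suc k)" if "good (w @ [False]) k" "good (w @ [True]) k" for w k
    unfolding good_def
  proof (intro allI impI)
    fix z x y assume z: "Suc k \<le> length z" and xy: "prefix_of (w @ z) x" "prefix_of (w @ z) y"
    then obtain b z' where z': "z = b # z'" "k \<le> length z'"
      by (cases z) auto
    moreover have "good (w @ [b]) k"
      using that by (cases b) auto
    ultimately show "\<bar>f x - f y\<bar> < e"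
      using xy unfolding good_def by simp
  qed
  have "\<exists>k. good [] k"
  proof (rule ccontr)
    assume bad_Nil: "\<not> ?thesis"
    \<comment> \<open>The choice of a bad child is encoded as a labelling, so that
      \<open>descent\<close> can be reused: input 0 turns right at label 0, where the left child is
      good, and left at label 1, where it is bad.\<close>
    define l :: "bool list \<Rightarrow> real" where
      "l w = (if \<exists>k. good (w @ [False]) k then 0 else 1)" for w
    define v where "v = itinerary l 0"
    have bad: "\<not> (\<exists>k. good (descent l 0 n) k)" for n
    proof (induction n)
      case (Suc n)
      show ?case
      proof
        assume *: "\<exists>k. good (descent l 0 (Suc n)) k"
        show False
        proof (cases "\<exists>k. good (descent l 0 n @ [False]) k")
          case True
          then obtain k k' where "good (descent l 0 n @ [False]) k" "good (descent l 0 n @ [True]) k'"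
            using * by (auto simp: l_def)
          then have "good (descent l 0 n) (Suc (max k k'))"
            by (intro step) (auto elim: good_mono)
          with Suc show False by blast
        next
          case False
          then show False
            using * by (auto simp: l_def)
        qed
      qed
    qed (use bad_Nil in simp)
    obtain d where d: "0 < d" "\<And>x. dist x (End v) < d \<Longrightarrow> \<bar>f x - f (End v)\<bar> < e / 2"
      using f e unfolding continuous_on_iff by (metis UNIV_I dist_real_def half_gt_zero)
    obtain n where n: "(1 / 2) ^ n < d"
      using half_power_less[OF d(1)] .
    have close: "\<bar>f x - f (End v)\<bar> < e / 2" if "prefix_of (descent l 0 n @ z) x" for x z
    proof (rule d(2))
      have "prefix_of (map v [0..<n]) x"
        using prefix_of_prefix[OF _ that] by (simp add: v_def flip: descent_eq_map)
      then show "dist x (End v) < d"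
        using dist_End_le n by (meson le_less_trans)
    qed
    have "good (descent l 0 n) 0"
      unfolding good_def
    proof (intro allI impI)
      fix z x y assume "prefix_of (descent l 0 n @ z) x" "prefix_of (descent l 0 n @ z) y"
      then show "\<bar>f x - f y\<bar> < e"
        using close[of z x] close[of z y] by linarith
    qed
    with bad show False by blast
  qed
  then obtain k where "good [] k" ..
  then show ?thesis
    unfolding good_def by (metis append_Nil order_refl)
qed

lemma integral_unif:
  fixes f :: "vbar \<Rightarrow> real"
  assumes "finite A" "f \<in> borel_measurable borel"
  shows "(\<integral>x. f x \<partial>unif A) = (\<Sum>v\<in>A. f (Vertex v)) / card A"
proof -
  have "Vertex \<in> uniform_count_measure A \<rightarrow>\<^sub>M borel"
    by (simp add: measurable_def sets_uniform_count_measure space_uniform_count_measure)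
  then show ?thesis
    using assms by (simp add: unif_def integral_distr integral_uniform_count_measure)
qed

lemma finite_lists_length: "finite {w :: bool list. length w = k}"
  using finite_lists_length_eq[of "UNIV :: bool set" k] by simp

text \<open>With \<open>k\<close> from \<open>oscillation_small\<close>, \<open>f\<close> is
  replaced by \<open>G\<close>, which takes the value of \<open>f\<close> at the prefix of length
  \<open>k\<close> and is 0 on the finitely many shorter nodes. Averages of \<open>G\<close> are
  linear combinations of prefix frequencies, so they converge by \<open>freq\<close>; the short
  nodes cost at most a constant over \<open>n\<close>.\<close>

lemma weakly_converges_to_on_vbar:
  fixes T :: "nat \<Rightarrow> bool list set"
  assumes T: "\<And>n. finite (T n)" "\<And>n. card (T n) = n"
    and \<mu>: "prob_space \<mu>" "sets \<mu> = sets boundary"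
    and freq: "\<And>w. (\<lambda>n. real (card {v \<in> T n. prefix w v}) / real n) \<longlonglongrightarrow> measure \<mu> (cyl w)"
  shows "weakly_converges_to (\<lambda>n. unif (T n)) (on_vbar \<mu>)"
  unfolding weakly_converges_to_def
proof (intro allI impI)
  fix f :: "vbar \<Rightarrow> real"
  assume "continuous_on UNIV f \<and> bounded (range f)"
  then have cont: "continuous_on UNIV f" and "bounded (range f)"
    by auto
  then obtain B where B: "\<And>x. \<bar>f x\<bar> \<le> B"
    by (auto simp: bounded_iff)
  have f [measurable]: "f \<in> borel_measurable borel"
    using cont by (rule borel_measurable_continuous_onI)
  interpret \<mu>: prob_space \<mu> by fact
  have End [measurable]: "End \<in> \<mu> \<rightarrow>\<^sub>M borel"
    using measurable_End measurable_cong_sets[OF \<mu>(2) refl] by blast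
  have cyl [measurable]: "cyl w \<in> sets \<mu>" for w
    using sets_cyl \<mu>(2) by blast
  have space: "space \<mu> = UNIV"
    using sets_eq_imp_space_eq[OF \<mu>(2)] by simp
  define I where "I = (\<integral>v. f (End v) \<partial>\<mu>)"
  have I: "(\<integral>x. f x \<partial>on_vbar \<mu>) = I"
    unfolding on_vbar_def I_def by (rule integral_distr) auto
  define a where "a n = (\<Sum>v\<in>T n. f (Vertex v)) / real n" for n
  have a: "(\<integral>x. f x \<partial>unif (T n)) = a n" for n
    using T by (simp add: integral_unif a_def)
  have "a \<longlonglongrightarrow> I"
  proof (rule LIMSEQ_I)
    fix r :: real assume "0 < r"
    \<comment> \<open>Four errors of size \<open>e\<close>: one for replacing \<open>f\<close> by
      \<open>G\<close> under \<open>\<mu>\<close>, two in \<open>a_c\<close>, one for the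
      frequencies.\<close>
    define e where "e = r / 4"
    have e: "0 < e" using \<open>0 < r\<close> by (simp add: e_def)
    obtain k where k: "\<And>w x y. length w = k \<Longrightarrow> prefix_of w x \<Longrightarrow> prefix_of w y \<Longrightarrow> \<bar>f x - f y\<bar> < e"
      using oscillation_small[OF cont e] by metis
    define W where "W = {w :: bool list. length w = k}"
    have W [simp]: "finite W"
      by (simp add: W_def finite_lists_length)
    define G where "G x = (\<Sum>w\<in>W. f (Vertex w) * of_bool (prefix_of w x))" for x
    have G: "G x = f (Vertex w)" if "w \<in> W" "prefix_of w x" for w x
    proof -
      have "f (Vertex w') * of_bool (prefix_of w' x) = (if w' = w then f (Vertex w) else 0)"
        if "w' \<in> W" for w'
      proof -
        have "prefix_of w' x \<longleftrightarrow> w' = w"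
          using that \<open>w \<in> W\<close> \<open>prefix_of w x\<close> prefix_of_unique unfolding W_def by blast
        then show ?thesis by simp
      qed
      then show ?thesis
        unfolding G_def using \<open>w \<in> W\<close> by (simp cong: sum.cong)
    qed
    have close: "\<bar>f x - G x\<bar> \<le> e" if "w \<in> W" "prefix_of w x" for w x
      using G[OF that] k[of w x "Vertex w"] that by (auto simp: W_def less_imp_le)
    define J where "J = (\<Sum>w\<in>W. f (Vertex w) * measure \<mu> (cyl w))"
    have int_f: "integrable \<mu> (\<lambda>v. f (End v))"
      by (rule \<mu>.integrable_const_bound[where B = B]) (auto simp: B)
    have GEnd: "G (End v) = (\<Sum>w\<in>W. f (Vertex w) * indicator (cyl w) v)" for v
      unfolding G_def by (intro sum.cong refl) (simp add: cyl_def indicator_def)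
    have int_G: "integrable \<mu> (\<lambda>v. G (End v))"
      unfolding GEnd by (intro Bochner_Integration.integrable_sum integrable_mult_right integrable_real_indicator)
        (simp_all add: \<mu>.emeasure_finite flip: top.not_eq_extremum)
    have J: "J = (\<integral>v. G (End v) \<partial>\<mu>)"
      unfolding GEnd J_def
      by (subst Bochner_Integration.integral_sum)
        (auto intro!: integrable_mult_right integrable_real_indicator
          simp: \<mu>.emeasure_finite space simp flip: top.not_eq_extremum)
    have "\<bar>I - J\<bar> \<le> e"
    proof -
      have "\<bar>f (End v) - G (End v)\<bar> \<le> e" for v
        by (rule close[of "map v [0..<k]"]) (simp_all add: W_def)
      then have "\<bar>\<integral>v. f (End v) - G (End v) \<partial>\<mu>\<bar> \<le> (\<integral>v. e \<partial>\<mu>)"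
        using int_f int_G
        by (intro order_trans[OF integral_abs_bound] integral_mono) auto
      then show ?thesis
        using int_f int_G by (simp add: I_def J \<mu>.prob_space)
    qed
    define c where "c n = (\<Sum>w\<in>W. f (Vertex w) * (real (card {v \<in> T n. prefix w v}) / real n))" for n
    have c_lim: "c \<longlonglongrightarrow> J"
      unfolding c_def J_def by (intro tendsto_sum tendsto_mult tendsto_const freq)
    have c: "c n = (\<Sum>v\<in>T n. G (Vertex v)) / real n" for n
    proof -
      have "(\<Sum>v\<in>T n. G (Vertex v)) = (\<Sum>w\<in>W. \<Sum>v\<in>T n. f (Vertex w) * of_bool (prefix w v))"
        unfolding G_def by (subst sum.swap) simp
      also have "\<dots> = (\<Sum>w\<in>W. f (Vertex w) * real (card {v \<in> T n. prefix w v}))"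
        using T(1) by (simp add: Int_def flip: sum_distrib_left)
      finally show ?thesis
        by (simp add: c_def sum_divide_distrib)
    qed
    define S where "S = (\<Union>j\<in>{..<k}. {v :: bool list. length v = j})"
    have S: "finite S"
      by (auto simp: S_def finite_lists_length)
    have a_c: "\<bar>a n - c n\<bar> \<le> e + B * real (card S) / real n" for n
    proof (cases "n = 0")
      \<comment> \<open>Both averages are quotients by 0, hence 0.\<close>
      case True
      then show ?thesis using e by (simp add: a_def c)
    next
      case False
      have B0: "0 \<le> B"
        using B[of "Vertex []"] by simp
      have "\<bar>f (Vertex v) - G (Vertex v)\<bar> \<le> e + B * indicator S v" for v
      proof (cases "v \<in> S")
        case True
        then have "\<not> prefix w v" if "w \<in> W" for w
          using that prefix_length_le[of w v] by (auto simp: S_def W_def)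
        then have "G (Vertex v) = 0"
          unfolding G_def by (intro sum.neutral) auto
        then show ?thesis
          using True B[of "Vertex v"] e by simp
      next
        case False
        then have "\<bar>f (Vertex v) - G (Vertex v)\<bar> \<le> e"
          by (intro close[of "take k v"]) (auto simp: S_def W_def take_is_prefix)
        with False show ?thesis by simp
      qed
      then have "\<bar>\<Sum>v\<in>T n. f (Vertex v) - G (Vertex v)\<bar> \<le> (\<Sum>v\<in>T n. e + B * indicator S v)"
        by (intro order_trans[OF sum_abs] sum_mono)
      also have "\<dots> = real n * e + B * real (card (T n \<inter> S))"
        using T by (simp add: sum.distrib sum_distrib_left[symmetric] indicator_def Int_def)
      also have "\<dots> \<le> real n * e + B * real (card S)"
        using S B0 by (intro add_left_mono mult_left_mono of_nat_mono card_mono) auto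
      finally have "\<bar>\<Sum>v\<in>T n. f (Vertex v) - G (Vertex v)\<bar> / real n \<le>
          (real n * e + B * real (card S)) / real n"
        by (rule divide_right_mono) simp
      then show ?thesis
        using False by (simp add: a_def c sum_subtractf add_divide_distrib flip: diff_divide_distrib)
    qed
    have "(\<lambda>n. B * real (card S) / real n) \<longlonglongrightarrow> 0"
      by (rule lim_const_over_n)
    then have "\<forall>\<^sub>F n in sequentially. B * real (card S) / real n < e"
      using e by (rule order_tendstoD)
    moreover have "\<forall>\<^sub>F n in sequentially. \<bar>c n - J\<bar> < e"
      using tendstoD[OF c_lim e] by (simp add: dist_real_def)
    ultimately have "\<forall>\<^sub>F n in sequentially. norm (a n - I) < r"
    proof eventually_elim
      fix n assume "B * real (card S) / real n < e" "\<bar>c n - J\<bar> < e"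
      then show "norm (a n - I) < r"
        using a_c[of n] \<open>\<bar>I - J\<bar> \<le> e\<close> unfolding e_def real_norm_def by linarith
    qed
    then show "\<exists>n0. \<forall>n\<ge>n0. norm (a n - I) < r"
      by (simp add: eventually_sequentially)
  qed
  then show "(\<lambda>n. \<integral>x. f x \<partial>unif (T n)) \<longlonglongrightarrow> (\<integral>x. f x \<partial>on_vbar \<mu>)"
    by (simp add: a I)
qed

section \<open>The limit measure\<close>

abbreviation (input) uniform01 :: "real measure" where
  "uniform01 \<equiv> uniform_measure lborel {0<..<1}"

text \<open>Defined for arbitrary labels, so that the random measure is a probability measure at
  every outcome and not merely on the generic ones.\<close>

definition limit_measure :: "(bool list \<Rightarrow> real) \<Rightarrow> (nat \<Rightarrow> bool) measure" where
  "limit_measure l = distr uniform01 boundary (itinerary l)"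

lemma prob_space_uniform01: "prob_space uniform01"
  by (rule prob_space_uniform_measure) auto

interpretation uniform01: prob_space uniform01
  by (rule prob_space_uniform01)

lemma AE_uniform01: "AE x in uniform01. 0 < x \<and> x < 1"
  by (rule AE_uniform_measureI) auto

lemma measure_uniform01_Ico:
  assumes "0 \<le> a" "b \<le> 1"
  shows "measure uniform01 {a..<b} = max 0 (b - a)"
proof -
  have "{0<..<1} \<inter> {a..<b} = (if a = 0 then {a<..<b} else {a..<b})"
    using assms by auto
  then show ?thesis
    using assms by (cases "a < b") (simp_all add: max_def)
qed

text \<open>The node whose label is read next is itself random, but it takes countably many
  values.\<close>

lemma measurable_descent:
  assumes [measurable]: "f \<in> borel_measurable M" "\<And>u. (\<lambda>\<omega>. l \<omega> u) \<in> borel_measurable M"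
  shows "(\<lambda>\<omega>. descent (l \<omega>) (f \<omega>) k) \<in> M \<rightarrow>\<^sub>M count_space UNIV"
proof (induction k)
  case (Suc k)
  have "(\<lambda>\<omega>. (\<lambda>v. v @ [l \<omega> v \<le> f \<omega>]) (descent (l \<omega>) (f \<omega>) k)) \<in> M \<rightarrow>\<^sub>M count_space UNIV"
    by (rule measurable_compose_countable[OF _ Suc]) measurable
  then show ?case by simp
qed simp

lemma measurable_itinerary:
  assumes [measurable]: "f \<in> borel_measurable M" "\<And>u. (\<lambda>\<omega>. l \<omega> u) \<in> borel_measurable M"
  shows "(\<lambda>\<omega>. itinerary (l \<omega>) (f \<omega>)) \<in> M \<rightarrow>\<^sub>M boundary"
proof -
  have [measurable]: "(\<lambda>\<omega>. l \<omega> (descent (l \<omega>) (f \<omega>) k)) \<in> borel_measurable M" for k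
    by (rule measurable_compose_countable[where f = "\<lambda>u \<omega>. l \<omega> u", OF _ measurable_descent]) measurable
  show ?thesis
    unfolding boundary_def itinerary_def [abs_def]
    by (intro measurable_abs_UNIV) measurable
qed

lemma measurable_limit_measure:
  assumes [measurable]: "\<And>u. (\<lambda>\<omega>. l \<omega> u) \<in> borel_measurable M"
  shows "(\<lambda>\<omega>. limit_measure (l \<omega>)) \<in> M \<rightarrow>\<^sub>M prob_algebra boundary"
  unfolding limit_measure_def
proof (rule measurable_distr_prob_space2)
  show "(\<lambda>\<omega>. uniform01) \<in> M \<rightarrow>\<^sub>M prob_algebra uniform01"
    by (intro measurable_const) (simp add: space_prob_algebra prob_space_uniform01)
  have [measurable]: "snd \<in> borel_measurable (M \<Otimes>\<^sub>M uniform01)"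
    using measurable_snd[of M uniform01] by simp
  show "(\<lambda>(\<omega>, x). itinerary (l \<omega>) x) \<in> M \<Otimes>\<^sub>M uniform01 \<rightarrow>\<^sub>M boundary"
    unfolding case_prod_beta' by (intro measurable_itinerary) measurable
qed

lemma itinerary_measurable: "itinerary l \<in> uniform01 \<rightarrow>\<^sub>M boundary"
  using measurable_itinerary[of "\<lambda>x. x" uniform01 "\<lambda>_. l"] by simp

lemma prob_space_limit_measure: "prob_space (limit_measure l)"
  unfolding limit_measure_def by (rule uniform01.prob_space_distr) (rule itinerary_measurable)

lemma sets_limit_measure: "sets (limit_measure l) = sets boundary"
  by (simp add: limit_measure_def)

text \<open>For arbitrary labels the interval may be empty with its ends in the wrong order; hence
  the \<open>max\<close>.\<close>

lemma measure_limit_cyl: "measure (limit_measure l) (cyl u) = max 0 (hi l u - lo l u)"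
proof -
  have "measure (limit_measure l) (cyl u) = measure uniform01 (itinerary l -` cyl u)"
    unfolding limit_measure_def using measure_distr[OF itinerary_measurable sets_cyl] by simp
  also have "\<dots> = measure uniform01 {lo l u..<hi l u}"
  proof (rule measure_eq_AE)
    show "AE x in uniform01. x \<in> itinerary l -` cyl u \<longleftrightarrow> x \<in> {lo l u..<hi l u}"
      using AE_uniform01
    proof eventually_elim
      fix x :: real assume "0 < x \<and> x < 1"
      then show "x \<in> itinerary l -` cyl u \<longleftrightarrow> x \<in> {lo l u..<hi l u}"
        using descent_iff_interval[of x u l]
        by (simp only: vimage_eq itinerary_in_cyl atLeastLessThan_iff less_imp_le simp_thms)
    qed
    show "itinerary l -` cyl u \<in> sets uniform01"
      using measurable_sets[OF itinerary_measurable[of l] sets_cyl[of u]] by simp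
  qed simp
  also have "\<dots> = max 0 (hi l u - lo l u)"
    by (intro measure_uniform01_Ico lo_nonneg hi_le_1)
  finally show ?thesis .
qed

lemma (in generic_input) measure_limit_cyl_label:
  "measure (limit_measure l) (cyl u) = hi l u - lo l u"
  using lo_less_hi[of u] by (simp add: measure_limit_cyl)

lemma (in generic_input) trees_converge:
  "weakly_converges_to (\<lambda>n. unif (bst_tree t n)) (on_vbar (limit_measure l))"
  by (rule weakly_converges_to_on_vbar)
    (simp_all add: card_bst_tree prob_space_limit_measure measure_limit_cyl_label tree_prefix_freq
      sets_limit_measure)

section \<open>Uniform inputs are almost surely generic\<close>

lemma measure_uniform01_lessThan:
  assumes "0 < q" "q < 1"
  shows "measure uniform01 {..<q} = q"
proof -
  have "{0<..<1} \<inter> {..<q} = {0<..<q}"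
    using assms by auto
  then show ?thesis
    using assms by simp
qed

lemma AE_uniform01_neq: "AE x in uniform01. x \<noteq> a"
  by (rule AE_uniform_measureI) (auto intro: eventually_mono[OF AE_lborel_singleton[of a]])

locale uniform_inputs = prob_space M for M :: "'a measure" +
  fixes \<eta> :: "nat \<Rightarrow> 'a \<Rightarrow> real"
  assumes indep: "indep_vars (\<lambda>_. borel) \<eta> {1..}"
    and distr_\<eta>: "\<And>i. i \<ge> 1 \<Longrightarrow> distr M borel (\<eta> i) = uniform01"
begin

lemma measurable_\<eta>: "i \<ge> 1 \<Longrightarrow> \<eta> i \<in> borel_measurable M"
  using indep by (auto simp: indep_vars_def)

lemma measurable_\<eta>_Suc [measurable]: "\<eta> (Suc i) \<in> borel_measurable M"
  by (rule measurable_\<eta>) simp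

lemma AE_between: "AE \<omega> in M. 0 < \<eta> (Suc i) \<omega> \<and> \<eta> (Suc i) \<omega> < 1"
  by (rule AE_distrD[OF measurable_\<eta>_Suc, where P = "\<lambda>x. 0 < x \<and> x < 1"])
    (subst distr_\<eta>, simp, rule AE_uniform01)

text \<open>The pair has the product law, under which each section of the diagonal is a single point
  and therefore null.\<close>

lemma AE_distinct:
  assumes "i \<noteq> j"
  shows "AE \<omega> in M. \<eta> (Suc i) \<omega> \<noteq> \<eta> (Suc j) \<omega>"
proof -
  interpret P: pair_sigma_finite uniform01 uniform01
    by unfold_locales
  have "indep_vars (\<lambda>_. borel) \<eta> (insert (Suc i) {Suc j})"
    by (rule indep_vars_subset[OF indep]) auto
  \<comment> \<open>The sum over a singleton is a device to obtain the independence of two single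
    inputs from \<open>indep_vars_sum\<close>.\<close>
  then have "indep_var borel (\<eta> (Suc i)) borel (\<lambda>\<omega>. \<Sum>k\<in>{Suc j}. \<eta> k \<omega>)"
    using assms by (intro indep_vars_sum) auto
  then have eq: "distr M (borel \<Otimes>\<^sub>M borel) (\<lambda>\<omega>. (\<eta> (Suc i) \<omega>, \<eta> (Suc j) \<omega>)) =
      uniform01 \<Otimes>\<^sub>M uniform01"
    by (simp add: indep_var_distribution_eq distr_\<eta>)
  have "AE p in uniform01 \<Otimes>\<^sub>M uniform01. fst p \<noteq> snd p"
  proof (rule P.AE_pair_measure)
    have "{p \<in> space (borel \<Otimes>\<^sub>M borel). fst p \<noteq> (snd p :: real)} \<in> sets (borel \<Otimes>\<^sub>M borel)"
      by measurable
    then show "{p \<in> space (uniform01 \<Otimes>\<^sub>M uniform01). fst p \<noteq> snd p} \<in> sets (uniform01 \<Otimes>\<^sub>M uniform01)"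
      using sets_pair_measure_cong[of uniform01 borel uniform01 borel] by (simp add: space_pair_measure)
    show "AE x in uniform01. AE y in uniform01. fst (x, y) \<noteq> snd (x, y)"
    proof (rule AE_I2)
      fix x
      show "AE y in uniform01. fst (x, y) \<noteq> snd (x, y)"
        using AE_uniform01_neq[of x] by eventually_elim simp
    qed
  qed
  from AE_distrD[OF _ this[folded eq]] show ?thesis
    by simp
qed

text \<open>Hoeffding's inequality bounds the probability of a deviation geometrically in
  \<open>n\<close>, so Borel-Cantelli applies.\<close>

lemma frequency_deviation:
  assumes q: "0 < q" "q < 1" and \<delta>: "0 < \<delta>"
  shows "AE \<omega> in M. \<forall>\<^sub>F n in sequentially.
    \<bar>real (card {i. i < n \<and> \<eta> (Suc i) \<omega> < q}) - real n * q\<bar> < real n * \<delta>"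
proof -
  define X where "X i \<omega> = (indicator {..<q} (\<eta> i \<omega>) :: real)" for i \<omega>
  have X_meas [measurable]: "X i \<in> borel_measurable M" if "i \<ge> 1" for i
    unfolding X_def using measurable_\<eta>[OF that] by measurable
  have E: "expectation (X i) = q" if "i \<ge> 1" for i
  proof -
    have "expectation (X i) = (\<integral>x. indicator {..<q} x \<partial>distr M borel (\<eta> i))"
      unfolding X_def using measurable_\<eta>[OF that] by (subst integral_distr) auto
    also have "\<dots> = measure uniform01 {..<q}"
      unfolding distr_\<eta>[OF that] by simp
    finally show ?thesis
      by (simp only: measure_uniform01_lessThan[OF q])
  qed
  define S where "S n \<omega> = (\<Sum>i\<in>{1..n}. X i \<omega>)" for n \<omega>
  have S: "S n \<omega> = real (card {i. i < n \<and> \<eta> (Suc i) \<omega> < q})" for n \<omega>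
  proof -
    have "S n \<omega> = (\<Sum>i<n. X (Suc i) \<omega>)"
      unfolding S_def by (rule sum.reindex_bij_witness[of _ Suc "\<lambda>i. i - 1"]) auto
    also have "\<dots> = real (card {i. i < n \<and> \<eta> (Suc i) \<omega> < q})"
      by (simp add: X_def indicator_def Int_def flip: sum.inter_filter)
    finally show ?thesis .
  qed
  have [measurable]: "S n \<in> borel_measurable M" for n
    unfolding S_def by (intro borel_measurable_sum X_meas) simp
  define A where "A n = {\<omega> \<in> space M. \<bar>S n \<omega> - real n * q\<bar> \<ge> real n * \<delta>}" for n
  have A_meas: "A n \<in> sets M" for n
    unfolding A_def by measurable
  have bound: "prob (A n) \<le> 2 * exp (- 2 * \<delta>\<^sup>2) ^ n" for n
  proof (cases "n = 0")
    case True
    then show ?thesis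
      by (simp add: order_trans[OF prob_le_1])
  next
    case False
    interpret H: indep_interval_bounded_random_variables M "{1..n}" X "\<lambda>_. 0" "\<lambda>_. 1"
    proof
      have "indep_vars (\<lambda>_. borel) (\<lambda>i \<omega>. indicator {..<q} (\<eta> i \<omega>) :: real) {1..n}"
        by (rule indep_vars_compose2[OF indep_vars_subset[OF indep]]) auto
      then show "indep_vars (\<lambda>_. borel) X {1..n}"
        by (simp add: X_def [abs_def])
    qed (auto simp: X_def indicator_def)
    interpret H: Hoeffding_ineq M "{1..n}" X "\<lambda>_. 0" "\<lambda>_. 1" "\<Sum>i\<in>{1..n}. expectation (X i)"
      by unfold_locales simp
    have \<mu>: "(\<Sum>i\<in>{1..n}. expectation (X i)) = real n * q"
      by (simp add: E)
    have "prob (A n) \<le> 2 * exp (- 2 * (real n * \<delta>)\<^sup>2 / (\<Sum>i\<in>{1..n}. (1 - 0)\<^sup>2))"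
      unfolding A_def S_def \<mu>[symmetric] using False \<delta> by (intro H.Hoeffding_ineq_abs_ge) auto
    \<comment> \<open>Each summand ranges over the unit interval, so the squared ranges add up to
      \<open>n\<close> and the exponent becomes linear in \<open>n\<close>.\<close>
    also have "- 2 * (real n * \<delta>)\<^sup>2 / (\<Sum>i\<in>{1..n}. (1 - 0)\<^sup>2) = real n * (- 2 * \<delta>\<^sup>2)"
      using False by (simp add: power2_eq_square field_simps)
    finally show ?thesis
      by (simp only: exp_of_nat_mult)
  qed
  have "summable (\<lambda>n. 2 * exp (- 2 * \<delta>\<^sup>2) ^ n)"
    using \<delta> by (intro summable_mult summable_geometric) auto
  then have "summable (\<lambda>n. prob (A n))"
    by (rule summable_comparison_test'[where N = 0]) (use bound in auto)
  then have "AE \<omega> in M. \<forall>\<^sub>F n in sequentially. \<omega> \<in> space M - A n"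
    by (intro borel_cantelli_AE1 A_meas) (simp_all add: emeasure_finite flip: top.not_eq_extremum)
  then show ?thesis
  proof eventually_elim
    fix \<omega> assume "\<forall>\<^sub>F n in sequentially. \<omega> \<in> space M - A n"
    then show "\<forall>\<^sub>F n in sequentially.
        \<bar>real (card {i. i < n \<and> \<eta> (Suc i) \<omega> < q}) - real n * q\<bar> < real n * \<delta>"
      by eventually_elim (auto simp: A_def S)
  qed
qed

lemma AE_frequency:
  assumes q: "0 < q" "q < 1"
  shows "AE \<omega> in M. (\<lambda>n. real (card {i. i < n \<and> \<eta> (Suc i) \<omega> < q}) / real n) \<longlonglongrightarrow> q"
proof -
  have "AE \<omega> in M. \<forall>m. \<forall>\<^sub>F n in sequentially.
      \<bar>real (card {i. i < n \<and> \<eta> (Suc i) \<omega> < q}) - real n * q\<bar> < real n * (1 / real (Suc m))"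
    unfolding AE_all_countable by (intro allI frequency_deviation q) simp
  then show ?thesis
  proof eventually_elim
    fix \<omega>
    let ?c = "\<lambda>n. real (card {i. i < n \<and> \<eta> (Suc i) \<omega> < q})"
    assume *: "\<forall>m. \<forall>\<^sub>F n in sequentially. \<bar>?c n - real n * q\<bar> < real n * (1 / real (Suc m))"
    show "(\<lambda>n. ?c n / real n) \<longlonglongrightarrow> q"
    proof (rule tendstoI)
      fix e :: real assume "0 < e"
      then obtain m where m: "1 / real (Suc m) < e"
        using nat_approx_posE by blast
      from *[rule_format, of m] eventually_gt_at_top[of 0]
      show "\<forall>\<^sub>F n in sequentially. dist (?c n / real n) q < e"
      proof eventually_elim
        fix n :: nat assume n: "\<bar>?c n - real n * q\<bar> < real n * (1 / real (Suc m))" "0 < n"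
        have "?c n / real n - q = (?c n - real n * q) / real n"
          using n(2) by (simp add: field_simps)
        then have "dist (?c n / real n) q = \<bar>?c n - real n * q\<bar> / real n"
          by (simp add: dist_real_def)
        also have "\<dots> < 1 / real (Suc m)"
          using n by (simp add: divide_less_eq mult.commute)
        finally show "dist (?c n / real n) q < e"
          using m by simp
      qed
    qed
  qed
qed

lemma AE_generic: "AE \<omega> in M. generic_input (\<lambda>i. \<eta> i \<omega>)"
proof -
  have 1: "AE \<omega> in M. \<forall>i. 0 < \<eta> (Suc i) \<omega> \<and> \<eta> (Suc i) \<omega> < 1"
    unfolding AE_all_countable using AE_between by blast
  have 2: "AE \<omega> in M. \<forall>i j. i \<noteq> j \<longrightarrow> \<eta> (Suc i) \<omega> \<noteq> \<eta> (Suc j) \<omega>"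
    unfolding AE_all_countable using AE_distinct by (intro allI) auto
  have 3: "AE \<omega> in M. \<forall>q\<in>\<rat> \<inter> {0<..<1}.
      (\<lambda>n. real (card {i. i < n \<and> \<eta> (Suc i) \<omega> < q}) / real n) \<longlonglongrightarrow> q"
    using AE_frequency by (subst AE_ball_countable) (auto intro: countable_Int1 countable_rat)
  from 1 2 3 show ?thesis
  proof eventually_elim
    fix \<omega>
    assume "\<forall>i. 0 < \<eta> (Suc i) \<omega> \<and> \<eta> (Suc i) \<omega> < 1"
      and "\<forall>i j. i \<noteq> j \<longrightarrow> \<eta> (Suc i) \<omega> \<noteq> \<eta> (Suc j) \<omega>"
      and "\<forall>q\<in>\<rat> \<inter> {0<..<1}. (\<lambda>n. real (card {i. i < n \<and> \<eta> (Suc i) \<omega> < q}) / real n) \<longlonglongrightarrow> q"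
    then show "generic_input (\<lambda>i. \<eta> i \<omega>)"
      by unfold_locales (auto intro!: injI)
  qed
qed

end

section \<open>The splitting ratios\<close>

text \<open>Conditionally on falling into an interval, a uniform point is uniform there. The centred
  form is the martingale increment, and it also covers an empty interval, where it is 0.\<close>

lemma integral_uniform01_rescaled:
  assumes [measurable]: "B \<in> sets borel" and ab: "0 \<le> a" "b \<le> 1"
  shows "(\<integral>y. indicator {a..<b} y * (indicator B ((y - a) / (b - a)) - measure uniform01 B) \<partial>uniform01) = 0"
proof (cases "a < b")
  case False
  then show ?thesis by simp
next
  case True
  \<comment> \<open>Open at \<open>a\<close>, so that the affine map carrying the unit interval onto
    the interval from \<open>a\<close> to \<open>b\<close> pulls \<open>S\<close> back to exactly
    \<open>{0<..<1} \<inter> B\<close>; the point \<open>a\<close> is null.\<close>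
  define S where "S = {y. a < y \<and> y < b \<and> (y - a) / (b - a) \<in> B}"
  have [measurable]: "S \<in> sets borel"
  proof -
    have "S = {y \<in> space borel. a < y \<and> y < b \<and> (y - a) / (b - a) \<in> B}"
      by (simp add: S_def)
    also have "\<dots> \<in> sets borel"
      by measurable
    finally show ?thesis .
  qed
  have "emeasure lborel S = (\<integral>\<^sup>+y. indicator S y \<partial>lborel)"
    by simp
  also have "\<dots> = ennreal \<bar>b - a\<bar> * (\<integral>\<^sup>+x. indicator S (a + (b - a) * x) \<partial>lborel)"
    using True by (intro nn_integral_real_affine) auto
  also have "(\<lambda>x. indicator S (a + (b - a) * x) :: ennreal) = indicator ({0<..<1} \<inter> B)"
  proof
    fix x
    have "a + (b - a) * x < b \<longleftrightarrow> (b - a) * x < (b - a) * 1"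
      by (simp add: algebra_simps)
    also have "\<dots> \<longleftrightarrow> x < 1"
      using True by (subst mult_less_cancel_left_pos) auto
    finally have "a + (b - a) * x \<in> S \<longleftrightarrow> x \<in> {0<..<1} \<inter> B"
      using True by (simp add: S_def zero_less_mult_iff)
    then show "indicator S (a + (b - a) * x) = (indicator ({0<..<1} \<inter> B) x :: ennreal)"
      by (simp add: indicator_def)
  qed
  finally have "measure lborel S = (b - a) * measure lborel ({0<..<1} \<inter> B)"
    using True by (simp add: measure_def enn2real_mult)
  moreover have "{0<..<1} \<inter> S = S"
    using ab by (auto simp: S_def)
  ultimately have S: "measure uniform01 S = (b - a) * measure uniform01 B"
    by simp
  have "(\<integral>y. indicator {a..<b} y * (indicator B ((y - a) / (b - a)) - measure uniform01 B) \<partial>uniform01) =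
      (\<integral>y. indicator S y - measure uniform01 B * indicator {a..<b} y \<partial>uniform01)"
  proof (intro integral_cong_AE)
    show "AE y in uniform01. indicator {a..<b} y *
        (indicator B ((y - a) / (b - a)) - measure uniform01 B) =
        indicator S y - measure uniform01 B * indicator {a..<b} y"
      using AE_uniform01_neq[of a] by eventually_elim (auto simp: S_def indicator_def)
  qed measurable
  also have "\<dots> = measure uniform01 S - measure uniform01 B * measure uniform01 {a..<b}"
  proof -
    have "integrable uniform01 (indicator A :: real \<Rightarrow> real)" if "A \<in> sets borel" for A
      using that by (intro uniform01.integrable_const_bound[where B = 1]) (auto simp: indicator_def)
    then show ?thesis
      by (subst Bochner_Integration.integral_diff) (simp_all del: measure_uniform_measure)
  qed
  also have "\<dots> = 0"
    using S True measure_uniform01_Ico[OF ab] by (simp del: measure_uniform_measure)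
  finally show ?thesis .
qed

text \<open>The splitting ratio in terms of labels, identified in \<open>ratio_eq\<close>. Only the
  labels of \<open>u\<close> and its prefixes enter, so it is settled as soon as \<open>u\<close> is
  filled.\<close>

definition ratio :: "(bool list \<Rightarrow> real) \<Rightarrow> bool list \<Rightarrow> real" where
  "ratio l u = (l u - lo l u) / (hi l u - lo l u)"

lemma ratio_cong: "(\<And>k. k \<le> length u \<Longrightarrow> l (take k u) = l' (take k u)) \<Longrightarrow> ratio l u = ratio l' u"
  unfolding ratio_def using lo_cong[of u l l'] hi_cong[of u l l'] by (metis less_imp_le order_refl take_all)

text \<open>
  For a node that is not yet occupied the factor is the probability that its ratio will lie in
  \<open>B\<close>; so products of factors form a martingale along the BST algorithm.
\<close>

definition factor :: "(bool list \<rightharpoonup> real) \<Rightarrow> bool list \<Rightarrow> real set \<Rightarrow> real" where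
  "factor L u B = (if u \<in> dom L then indicator B (ratio (\<lambda>v. the (L v)) u) else measure uniform01 B)"

lemma factor_bounds: "0 \<le> factor L u B" "factor L u B \<le> 1"
  unfolding factor_def
  by (auto simp: indicator_def uniform01.prob_le_1 simp del: measure_uniform_measure)

lemma abs_prod_factor_le: "\<bar>\<Prod>u\<in>F. factor L u (B u)\<bar> \<le> 1"
  by (simp add: abs_prod factor_bounds prod_le_1)

lemma measurable_lo [measurable (raw)]:
  "(\<And>u. (\<lambda>\<omega>. l \<omega> u) \<in> borel_measurable M) \<Longrightarrow> (\<lambda>\<omega>. lo (l \<omega>) u) \<in> borel_measurable M"
  by (induction u rule: rev_induct) (auto simp: lo_snoc)

lemma measurable_hi [measurable (raw)]:
  "(\<And>u. (\<lambda>\<omega>. l \<omega> u) \<in> borel_measurable M) \<Longrightarrow> (\<lambda>\<omega>. hi (l \<omega>) u) \<in> borel_measurable M"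
  by (induction u rule: rev_induct) (auto simp: hi_snoc)

text \<open>No sigma-field is put on the partial functions; this asks for measurability of the
  countably many coordinates through which they are used.\<close>

definition measurable_labelling :: "'a measure \<Rightarrow> ('a \<Rightarrow> (bool list \<rightharpoonup> real)) \<Rightarrow> bool" where
  "measurable_labelling M L \<longleftrightarrow>
    (\<forall>u. Measurable.pred M (\<lambda>\<omega>. u \<in> dom (L \<omega>)) \<and> (\<lambda>\<omega>. the (L \<omega> u)) \<in> borel_measurable M)"

lemma measurable_factor:
  assumes "measurable_labelling M L" and [measurable]: "B \<in> sets borel"
  shows "(\<lambda>\<omega>. factor (L \<omega>) u B) \<in> borel_measurable M"
proof -
  have [measurable]: "Measurable.pred M (\<lambda>\<omega>. v \<in> dom (L \<omega>))"
    "(\<lambda>\<omega>. the (L \<omega> v)) \<in> borel_measurable M" for v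
    using assms by (auto simp: measurable_labelling_def)
  show ?thesis
    unfolding factor_def ratio_def by measurable
qed

lemma measurable_labelling_insert:
  assumes L: "measurable_labelling M L" "\<And>\<omega>. finite (dom (L \<omega>))"
    and f [measurable]: "f \<in> borel_measurable M"
  shows "measurable_labelling M (\<lambda>\<omega>. (L \<omega>)(bst_position (f \<omega>) (L \<omega>) \<mapsto> f \<omega>))"
proof -
  have [measurable]: "Measurable.pred M (\<lambda>\<omega>. v \<in> dom (L \<omega>))"
    "(\<lambda>\<omega>. the (L \<omega> v)) \<in> borel_measurable M" for v
    using L by (auto simp: measurable_labelling_def)
  have pos [measurable]: "Measurable.pred M (\<lambda>\<omega>. bst_position (f \<omega>) (L \<omega>) = u)" for u
    unfolding bst_position_iff[OF L(2)] descent_iff by measurable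
  have "u \<in> dom ((L \<omega>)(bst_position (f \<omega>) (L \<omega>) \<mapsto> f \<omega>)) \<longleftrightarrow>
      bst_position (f \<omega>) (L \<omega>) = u \<or> u \<in> dom (L \<omega>)" for u \<omega>
    by auto
  moreover have "the (((L \<omega>)(bst_position (f \<omega>) (L \<omega>) \<mapsto> f \<omega>)) u) =
      (if bst_position (f \<omega>) (L \<omega>) = u then f \<omega> else the (L \<omega> u))" for u \<omega>
    by simp
  ultimately show ?thesis
    unfolding measurable_labelling_def by simp
qed

text \<open>One martingale step. The new node is free and the domain is prefix-stable, so it is a
  prefix of no occupied node and only its own factor changes. That change is a centred function of
  the input on the interval of the node and integrates to 0.\<close>

lemma integral_factor_insert:
  assumes L: "finite (dom L)" "\<And>u k. u \<in> dom L \<Longrightarrow> take k u \<in> dom L"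
    and F: "finite F" and B [measurable]: "\<And>u. B u \<in> sets borel"
  shows "(\<integral>y. (\<Prod>u\<in>F. factor (L(bst_position y L \<mapsto> y)) u (B u)) \<partial>uniform01) =
    (\<Prod>u\<in>F. factor L u (B u))"
proof -
  define l where "l = (\<lambda>v. the (L v))"
  \<comment> \<open>Candidates in \<open>F\<close> for the next node. Their proper prefixes are
    occupied, so their intervals are determined by existing labels.\<close>
  define ext where "ext = {w \<in> F. w \<notin> dom L \<and> (\<forall>k<length w. take k w \<in> dom L)}"
  have ext: "finite ext" "ext \<subseteq> F"
    using F by (auto simp: ext_def)
  define R where "R w = (\<Prod>u\<in>F - {w}. factor L u (B u))" for w
  \<comment> \<open>Increment of the factor at \<open>w\<close>, cut off to the inputs that land at
    \<open>w\<close>, while \<open>R w\<close> collects the other factors. Hence at most one summand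
    in \<open>step\<close> is nonzero for a given \<open>y\<close>.\<close>
  define h where "h w y = indicator {lo l w..<hi l w} y *
      (indicator (B w) ((y - lo l w) / (hi l w - lo l w)) - measure uniform01 (B w))" for w y
  have h_meas [measurable]: "h w \<in> borel_measurable borel" for w
    unfolding h_def by measurable
  have h_bound: "\<bar>h w y\<bar> \<le> 1" for w y
  proof -
    define c where "c = measure uniform01 (B w)"
    have "0 \<le> c" "c \<le> 1"
      by (simp_all add: c_def uniform01.prob_le_1 del: measure_uniform_measure)
    then show ?thesis
      unfolding h_def c_def[symmetric] by (auto simp: indicator_def abs_le_iff)
  qed
  have h_int: "integrable uniform01 (h w)" for w
    by (rule uniform01.integrable_const_bound[where B = 1]) (auto simp: h_bound)
  have step: "(\<Prod>u\<in>F. factor (L(bst_position y L \<mapsto> y)) u (B u)) =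
      (\<Prod>u\<in>F. factor L u (B u)) + (\<Sum>w\<in>ext. R w * h w y)" if y: "0 < y" "y < 1" for y
  proof -
    define v where "v = bst_position y L"
    have v: "v = descent l y (length v)" "v \<notin> dom L" "\<forall>k<length v. take k v \<in> dom L"
      using bst_position_iff[OF L(1), of y v] by (auto simp: v_def l_def)
    have v_eq: "v = w \<longleftrightarrow> y \<in> {lo l w..<hi l w}" if "w \<in> ext" for w
      using bst_position_iff[OF L(1), of y w] descent_iff_interval[of y w l] y that
      unfolding v_def[symmetric] l_def[symmetric] ext_def mem_Collect_eq atLeastLessThan_iff
      by (simp only: less_imp_le simp_thms) blast
    let ?L = "L(v \<mapsto> y)"
    have other: "factor ?L u (B u) = factor L u (B u)" if "u \<noteq> v" for u
    proof (cases "u \<in> dom L")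
      case True
      then have "take k u \<noteq> v" for k
        using L(2) v(2) by metis
      then have "ratio (\<lambda>w. the (?L w)) u = ratio (\<lambda>w. the (L w)) u"
        by (intro ratio_cong) simp
      then show ?thesis
        using True that by (simp add: factor_def)
    next
      case False
      then show ?thesis
        using that by (simp add: factor_def domIff)
    qed
    have new: "factor ?L v (B v) = indicator (B v) ((y - lo l v) / (hi l v - lo l v))"
    proof -
      have "the (?L (take k v)) = l (take k v)" if "k < length v" for k
        using v that by (auto simp: l_def)
      then have "lo (\<lambda>w. the (?L w)) v = lo l v" "hi (\<lambda>w. the (?L w)) v = hi l v"
        by (auto intro: lo_cong hi_cong)
      then show ?thesis
        by (simp add: factor_def ratio_def)
    qed
    have h0: "h w y = 0" if "w \<in> ext" "w \<noteq> v" for w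
      using v_eq[OF that(1)] that(2) by (auto simp: h_def)
    show ?thesis
    proof (cases "v \<in> F")
      case False
      have "(\<Sum>w\<in>ext. R w * h w y) = 0"
        using h0 False ext by (intro sum.neutral) auto
      moreover have "(\<Prod>u\<in>F. factor ?L u (B u)) = (\<Prod>u\<in>F. factor L u (B u))"
        using False by (intro prod.cong refl other) auto
      ultimately show ?thesis
        by (simp add: v_def)
    next
      case True
      then have v_ext: "v \<in> ext"
        using v by (simp add: ext_def)
      have "(\<Sum>w\<in>ext. R w * h w y) = R v * h v y"
        using h0 v_ext ext by (subst sum.remove[of _ v]) (auto intro!: sum.neutral)
      moreover have "(\<Prod>u\<in>F. factor ?L u (B u)) = factor ?L v (B v) * R v"
        unfolding R_def using True F by (subst prod.remove[of _ v]) (auto intro!: prod.cong other)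
      moreover have "(\<Prod>u\<in>F. factor L u (B u)) = measure uniform01 (B v) * R v"
        unfolding R_def using True F v(2) by (subst prod.remove[of _ v]) (auto simp: factor_def)
      moreover have "h v y = factor ?L v (B v) - measure uniform01 (B v)"
        using v_eq[OF v_ext] by (simp add: h_def new del: measure_uniform_measure)
      ultimately show ?thesis
        unfolding v_def[symmetric]
        by (simp only:) (simp add: algebra_simps del: measure_uniform_measure)
    qed
  qed
  have "(\<integral>y. (\<Prod>u\<in>F. factor L u (B u)) + (\<Sum>w\<in>ext. R w * h w y) \<partial>uniform01) =
      (\<Prod>u\<in>F. factor L u (B u))"
  proof -
    have "(\<integral>y. h w y \<partial>uniform01) = 0" for w
      unfolding h_def by (rule integral_uniform01_rescaled[OF B lo_nonneg hi_le_1])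
    then show ?thesis
      using h_int by (simp add: uniform01.prob_space)
  qed
  moreover have "(\<integral>y. (\<Prod>u\<in>F. factor (L(bst_position y L \<mapsto> y)) u (B u)) \<partial>uniform01) =
      (\<integral>y. (\<Prod>u\<in>F. factor L u (B u)) + (\<Sum>w\<in>ext. R w * h w y) \<partial>uniform01)"
  proof (rule integral_cong_AE)
    have "measurable_labelling uniform01 (\<lambda>y. L(bst_position y L \<mapsto> y))"
      by (rule measurable_labelling_insert) (auto simp: measurable_labelling_def L)
    then show "(\<lambda>y. \<Prod>u\<in>F. factor (L(bst_position y L \<mapsto> y)) u (B u)) \<in> borel_measurable uniform01"
      by (intro borel_measurable_prod measurable_factor B)
    show "AE y in uniform01. (\<Prod>u\<in>F. factor (L(bst_position y L \<mapsto> y)) u (B u)) =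
        (\<Prod>u\<in>F. factor L u (B u)) + (\<Sum>w\<in>ext. R w * h w y)"
      using AE_uniform01 by eventually_elim (rule step, auto)
  qed measurable
  ultimately show ?thesis by simp
qed


section \<open>Measurability of the labels and freezing of the factors\<close>

lemma measurable_labelling_bst:
  assumes "\<And>i. i < n \<Longrightarrow> f (Suc i) \<in> borel_measurable M"
  shows "measurable_labelling M (\<lambda>\<omega>. bst (\<lambda>i. f i \<omega>) n)"
  using assms
proof (induction n)
  case 0
  then show ?case
    by (simp add: measurable_labelling_def)
next
  case (Suc n)
  then show ?case
    unfolding bst.simps(2) by (intro measurable_labelling_insert finite_bst) auto
qed

lemma bst_cong: "(\<And>i. i < n \<Longrightarrow> t (Suc i) = t' (Suc i)) \<Longrightarrow> bst t n = bst t' n"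
  by (induction n) (simp_all add: bst.simps(2))

lemma bst_dom_take: "u \<in> dom (bst t n) \<Longrightarrow> take k u \<in> dom (bst t n)"
  using bst_tree_take unfolding bst_tree_def .

lemma measurable_label:
  assumes "\<And>i. f (Suc i) \<in> borel_measurable M"
  shows "(\<lambda>\<omega>. label (\<lambda>i. f i \<omega>) u) \<in> borel_measurable M"
proof -
  have [measurable]: "Measurable.pred M (\<lambda>\<omega>. u \<in> bst_tree (\<lambda>i. f i \<omega>) n)"
    "(\<lambda>\<omega>. the (bst (\<lambda>i. f i \<omega>) n u)) \<in> borel_measurable M" for n
    using measurable_labelling_bst[of n f M] assms
    by (auto simp: measurable_labelling_def bst_tree_def)
  show ?thesis
    unfolding label_def
    by (rule measurable_compose_countable[where f = "\<lambda>n \<omega>. the (bst (\<lambda>i. f i \<omega>) n u)"]) measurable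
qed

lemma (in generic_input) eventually_factor:
  assumes "finite F"
  shows "\<forall>\<^sub>F n in sequentially. \<forall>u\<in>F. factor (bst t n) u (B u) = indicator (B u) (ratio l u)"
proof (intro eventually_ball_finite assms ballI)
  fix u
  obtain m where m: "node t m = u"
    by (rule node_surj)
  show "\<forall>\<^sub>F n in sequentially. factor (bst t n) u (B u) = indicator (B u) (ratio l u)"
    using eventually_gt_at_top[of m]
  proof eventually_elim
    fix n assume "m < n"
    then have u: "u \<in> bst_tree t n"
      using m by (auto simp: bst_tree_eq)
    then have "ratio (\<lambda>v. the (bst t n v)) u = ratio l u"
      by (intro ratio_cong bst_label bst_tree_take)
    then show "factor (bst t n) u (B u) = indicator (B u) (ratio l u)"
      using u by (simp add: factor_def bst_tree_def)
  qed
qed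

lemma (in generic_input) ratio_eq:
  "ratio l u = measure (limit_measure l) (cyl (u @ [False])) / measure (limit_measure l) (cyl u)"
  using label_between(2)[of u] by (simp add: measure_limit_cyl_label ratio_def lo_snoc hi_snoc)

lemma (in generic_input) cyl_gap:
  "tau t u \<noteq> \<infinity> \<and>
    (let i = the_enat (tau t u) - 1; s = order_stat t i
     in strict_mono_on {0..i + 1} s \<and>
        (\<exists>j\<in>{0..i}.
           (\<forall>k\<in>{0..i}. s k < t (i + 1) \<and> t (i + 1) < s (k + 1) \<longleftrightarrow> k = j) \<and>
           measure (limit_measure l) (cyl u) = s (j + 1) - s j))"
proof -
  obtain m where m: "node t m = u"
    by (rule node_surj)
  then have tau: "tau t u = enat (Suc m)"
    using tau_node by metis
  show ?thesis
    using order_stat_gap[of m] unfolding tau m measure_limit_cyl_label by (simp add: Let_def)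
qed

section \<open>Expectation of the products and joint law of the ratios\<close>

context uniform_inputs
begin

text \<open>On the product space of the first \<open>n\<close> inputs, Fubini integrates out the
  last coordinate, which undoes one insertion. At \<open>n = 0\<close> no node is occupied and every
  factor is a constant.\<close>

lemma expectation_factors:
  assumes F: "finite F" and B: "\<And>u. B u \<in> sets borel"
  shows "expectation (\<lambda>\<omega>. \<Prod>u\<in>F. factor (bst (\<lambda>i. \<eta> i \<omega>) n) u (B u)) =
    (\<Prod>u\<in>F. measure uniform01 (B u))"
proof -
  interpret P: product_prob_space "\<lambda>_ :: nat. uniform01"
    by (intro product_prob_spaceI prob_space_uniform01)
  define \<Phi> where "\<Phi> n t = (\<Prod>u\<in>F. factor (bst t n) u (B u))" for n t
  have \<Phi>_meas: "(\<lambda>\<omega>. \<Phi> n (\<lambda>i. f i \<omega>)) \<in> borel_measurable N"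
    if "\<And>i. i < n \<Longrightarrow> f (Suc i) \<in> borel_measurable N" for f n and N :: "'b measure"
    unfolding \<Phi>_def
    by (intro borel_measurable_prod measurable_factor measurable_labelling_bst B that)
  have \<Phi>_PiM: "\<Phi> n \<in> borel_measurable (\<Pi>\<^sub>M i\<in>{1..n}. N)" if "sets N = sets borel" for n N
  proof (rule \<Phi>_meas)
    fix i assume "i < n"
    then have "(\<lambda>x. x (Suc i)) \<in> (\<Pi>\<^sub>M i\<in>{1..n}. N) \<rightarrow>\<^sub>M N"
      by (intro measurable_component_singleton) auto
    then show "(\<lambda>x. x (Suc i)) \<in> borel_measurable (\<Pi>\<^sub>M i\<in>{1..n}. N)"
      using measurable_cong_sets[OF refl that] by blast
  qed
  have \<Phi>_int: "integrable (\<Pi>\<^sub>M i\<in>{1..n}. uniform01) (\<Phi> n)" for n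
  proof -
    interpret Pn: prob_space "\<Pi>\<^sub>M i\<in>{1..n}. uniform01"
      by (intro prob_space_PiM prob_space_uniform01)
    show ?thesis
    proof (rule Pn.integrable_const_bound[where B = 1])
      show "\<Phi> n \<in> borel_measurable (\<Pi>\<^sub>M i\<in>{1..n}. uniform01)"
        by (rule \<Phi>_PiM) simp
    qed (simp add: \<Phi>_def abs_prod_factor_le)
  qed
  have int: "(\<integral>x. \<Phi> n x \<partial>(\<Pi>\<^sub>M i\<in>{1..n}. uniform01)) = (\<Prod>u\<in>F. measure uniform01 (B u))" for n
  proof (induction n)
    case 0
    interpret P0: prob_space "\<Pi>\<^sub>M i\<in>({} :: nat set). uniform01"
      by (intro prob_space_PiM prob_space_uniform01)
    show ?case
      unfolding \<Phi>_def by (simp add: factor_def P0.prob_space del: measure_uniform_measure)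
  next
    case (Suc n)
    have ins: "{1..Suc n} = insert (Suc n) {1..n}"
      by auto
    have "(\<integral>x. \<Phi> (Suc n) x \<partial>(\<Pi>\<^sub>M i\<in>{1..Suc n}. uniform01)) =
        (\<integral>x. (\<integral>y. \<Phi> (Suc n) (x(Suc n := y)) \<partial>uniform01) \<partial>(\<Pi>\<^sub>M i\<in>{1..n}. uniform01))"
      using \<Phi>_int[of "Suc n"] unfolding ins by (intro P.product_integral_insert) auto
    also have "(\<lambda>x. \<integral>y. \<Phi> (Suc n) (x(Suc n := y)) \<partial>uniform01) = \<Phi> n"
    proof
      fix x :: "nat \<Rightarrow> real"
      have "bst (x(Suc n := y)) n = bst x n" for y
        by (rule bst_cong) simp
      then have "bst (x(Suc n := y)) (Suc n) = (bst x n)(bst_position y (bst x n) \<mapsto> y)" for y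
        by (simp add: bst.simps(2))
      then show "(\<integral>y. \<Phi> (Suc n) (x(Suc n := y)) \<partial>uniform01) = \<Phi> n x"
        unfolding \<Phi>_def by (simp only:) (intro integral_factor_insert finite_bst bst_dom_take F B)
    qed
    finally show ?case
      using Suc by simp
  qed
  have "expectation (\<lambda>\<omega>. \<Phi> n (\<lambda>i. \<eta> i \<omega>)) = (\<Prod>u\<in>F. measure uniform01 (B u))"
  proof (cases "n = 0")
    case True
    then show ?thesis
      by (simp add: \<Phi>_def factor_def prob_space del: measure_uniform_measure)
  next
    case False
    \<comment> \<open>The tree at time \<open>n\<close> reads only the inputs 1 to \<open>n\<close>,
      so \<open>\<eta>\<close> may be replaced by its restriction, whose law is the product
      measure.\<close>
    let ?r = "\<lambda>\<omega>. \<lambda>i\<in>{1..n}. \<eta> i \<omega>"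
    have "indep_vars (\<lambda>_. borel) \<eta> {1..n}"
      by (rule indep_vars_subset[OF indep]) auto
    then have "distr M (\<Pi>\<^sub>M i\<in>{1..n}. borel) ?r = (\<Pi>\<^sub>M i\<in>{1..n}. distr M borel (\<eta> i))"
      using False by (subst (asm) indep_vars_iff_distr_eq_PiM') (auto intro: measurable_\<eta>)
    also have "\<dots> = (\<Pi>\<^sub>M i\<in>{1..n}. uniform01)"
      by (intro PiM_cong refl distr_\<eta>) simp
    finally have "(\<integral>x. \<Phi> n x \<partial>distr M (\<Pi>\<^sub>M i\<in>{1..n}. borel) ?r) = (\<Prod>u\<in>F. measure uniform01 (B u))"
      using int by simp
    moreover have "(\<integral>x. \<Phi> n x \<partial>distr M (\<Pi>\<^sub>M i\<in>{1..n}. borel) ?r) = expectation (\<lambda>\<omega>. \<Phi> n (?r \<omega>))"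
      by (intro integral_distr \<Phi>_PiM measurable_restrict measurable_\<eta>) auto
    moreover have "\<Phi> n (?r \<omega>) = \<Phi> n (\<lambda>i. \<eta> i \<omega>)" for \<omega>
      unfolding \<Phi>_def by (intro prod.cong refl arg_cong[where f = "\<lambda>L. factor L _ _"] bst_cong) auto
    ultimately show ?thesis by simp
  qed
  then show ?thesis
    by (simp add: \<Phi>_def)
qed

abbreviation X :: "'a \<Rightarrow> (nat \<Rightarrow> bool) measure" where
  "X \<omega> \<equiv> limit_measure (label (\<lambda>i. \<eta> i \<omega>))"

lemma measurable_X: "X \<in> M \<rightarrow>\<^sub>M prob_algebra boundary"
  by (intro measurable_limit_measure measurable_label) measurable

abbreviation \<xi> :: "bool list \<Rightarrow> 'a \<Rightarrow> real" where
  "\<xi> u \<omega> \<equiv> measure (X \<omega>) (cyl (u @ [False])) / measure (X \<omega>) (cyl u)"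

lemma measurable_\<xi> [measurable]: "\<xi> u \<in> borel_measurable M"
proof -
  have "(\<lambda>\<omega>. measure (X \<omega>) (cyl w)) \<in> borel_measurable M" for w
    by (intro measurable_compose[OF measurable_prob_algebraD[OF measurable_X]]
        measurable_measure_subprob_algebra sets_cyl)
  then show ?thesis
    by measurable
qed

text \<open>One formula for both claims of part (c): singletons \<open>F\<close> give the law of
  each ratio, and general finite \<open>F\<close> then give the independence.\<close>

lemma prob_\<xi>:
  assumes F: "finite F" and B [measurable]: "\<And>u. B u \<in> sets borel"
  shows "prob {\<omega> \<in> space M. \<forall>u\<in>F. \<xi> u \<omega> \<in> B u} = (\<Prod>u\<in>F. measure uniform01 (B u))"
proof -
  let ?s = "\<lambda>n \<omega>. \<Prod>u\<in>F. factor (bst (\<lambda>i. \<eta> i \<omega>) n) u (B u)"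
  let ?f = "\<lambda>\<omega>. \<Prod>u\<in>F. indicator (B u) (\<xi> u \<omega>) :: real"
  have "(\<lambda>n. expectation (?s n)) \<longlonglongrightarrow> expectation ?f"
  proof (rule integral_dominated_convergence[where w = "\<lambda>_. 1"])
    show "?s n \<in> borel_measurable M" for n
      by (intro borel_measurable_prod measurable_factor measurable_labelling_bst B measurable_\<eta>_Suc)
    show "AE \<omega> in M. (\<lambda>n. ?s n \<omega>) \<longlonglongrightarrow> ?f \<omega>"
      using AE_generic
    proof eventually_elim
      fix \<omega> assume "generic_input (\<lambda>i. \<eta> i \<omega>)"
      then interpret generic_input "\<lambda>i. \<eta> i \<omega>" .
      show "(\<lambda>n. ?s n \<omega>) \<longlonglongrightarrow> ?f \<omega>"
      proof (rule tendsto_eventually)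
        show "\<forall>\<^sub>F n in sequentially. ?s n \<omega> = ?f \<omega>"
          using eventually_factor[OF F, of B]
          by eventually_elim (simp add: ratio_eq)
      qed
    qed
  qed (auto simp: abs_prod_factor_le)
  then have "expectation ?f = (\<Prod>u\<in>F. measure uniform01 (B u))"
    unfolding expectation_factors[OF F B] using LIMSEQ_unique tendsto_const by blast
  moreover have "?f \<omega> = indicator {\<omega>. \<forall>u\<in>F. \<xi> u \<omega> \<in> B u} \<omega>" for \<omega>
    using F by (induction F rule: finite_induct) (auto simp: indicator_def)
  ultimately have "expectation (indicator {\<omega>. \<forall>u\<in>F. \<xi> u \<omega> \<in> B u}) =
      (\<Prod>u\<in>F. measure uniform01 (B u))"
    by simp
  then show ?thesis
    by (simp add: Collect_conj_eq Int_commute)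
qed

lemma indep_\<xi>: "indep_vars (\<lambda>_. borel) \<xi> UNIV"
  unfolding indep_vars_def2
proof (intro conjI ballI measurable_\<xi> indep_setsI)
  fix u show "{\<xi> u -` A \<inter> space M |A. A \<in> sets borel} \<subseteq> events"
    using measurable_sets[OF measurable_\<xi>] by blast
next
  fix A J
  assume J: "J \<noteq> {}" "finite J" and "\<forall>j\<in>J. A j \<in> {\<xi> j -` B \<inter> space M |B. B \<in> sets borel}"
  then have "\<forall>j\<in>J. \<exists>B. B \<in> sets borel \<and> A j = \<xi> j -` B \<inter> space M"
    by blast
  from bchoice[OF this]
  obtain B' where B': "\<forall>j\<in>J. B' j \<in> sets borel \<and> A j = \<xi> j -` B' j \<inter> space M" ..
  \<comment> \<open>Filled up by the empty set outside \<open>J\<close>, because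
    \<open>prob_\<xi>\<close> asks for a Borel set at every node.\<close>
  define B where "B j = (if j \<in> J then B' j else {})" for j
  have B: "\<And>j. B j \<in> sets borel" "\<And>j. j \<in> J \<Longrightarrow> A j = \<xi> j -` B j \<inter> space M"
    using B' by (simp_all add: B_def)
  have "prob (A j) = measure uniform01 (B j)" if "j \<in> J" for j
  proof -
    have "A j = {\<omega> \<in> space M. \<forall>u\<in>{j}. \<xi> u \<omega> \<in> B u}"
      using B(2)[OF that] by auto
    then show ?thesis
      using prob_\<xi>[of "{j}" B] B(1) by simp
  qed
  moreover have "(\<Inter>j\<in>J. A j) = {\<omega> \<in> space M. \<forall>u\<in>J. \<xi> u \<omega> \<in> B u}"
    using J B(2) by auto
  ultimately show "prob (\<Inter>j\<in>J. A j) = (\<Prod>j\<in>J. prob (A j))"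
    using prob_\<xi>[OF J(2), of B] B(1) by simp
qed

lemma distr_\<xi>: "distr M borel (\<xi> u) = uniform01"
proof (rule measure_eqI)
  fix A assume "A \<in> sets (distr M borel (\<xi> u))"
  then have A: "A \<in> sets borel"
    by simp
  have "prob {\<omega> \<in> space M. \<forall>u\<in>{u}. \<xi> u \<omega> \<in> A} = measure uniform01 A"
    using prob_\<xi>[of "{u}" "\<lambda>_. A"] A by simp
  moreover have "{\<omega> \<in> space M. \<forall>u\<in>{u}. \<xi> u \<omega> \<in> A} = \<xi> u -` A \<inter> space M"
    by auto
  ultimately show "emeasure (distr M borel (\<xi> u)) A = emeasure uniform01 A"
    using A by (simp add: emeasure_distr emeasure_eq_measure uniform01.emeasure_eq_measure
        del: measure_uniform_measure emeasure_uniform_measure)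
qed simp

end

theorem theorem1:
  fixes M :: "'a measure" and \<eta> :: "nat \<Rightarrow> 'a \<Rightarrow> real"
  assumes "prob_space M"
    and "prob_space.indep_vars M (\<lambda>_. borel) \<eta> {1..}"
    and "\<And>i. i \<ge> 1 \<Longrightarrow> distr M borel (\<eta> i) = uniform_measure lborel {0<..<1}"
  shows "\<exists>X \<in> M \<rightarrow>\<^sub>M prob_algebra boundary.
    (AE \<omega> in M. weakly_converges_to (\<lambda>n. unif (bst_tree (\<lambda>i. \<eta> i \<omega>) n)) (on_vbar (X \<omega>))) \<and>
    (\<forall>u. u \<noteq> [] \<longrightarrow> (AE \<omega> in M.
        tau (\<lambda>k. \<eta> k \<omega>) u \<noteq> \<infinity> \<and>
        (let i = the_enat (tau (\<lambda>k. \<eta> k \<omega>) u) - 1;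
             s = order_stat (\<lambda>k. \<eta> k \<omega>) i
         in strict_mono_on {0..i + 1} s \<and>
            (\<exists>j\<in>{0..i}.
               (\<forall>k\<in>{0..i}. s k < \<eta> (i + 1) \<omega> \<and> \<eta> (i + 1) \<omega> < s (k + 1) \<longleftrightarrow> k = j) \<and>
               measure (X \<omega>) (cyl u) = s (j + 1) - s j)))) \<and>
    (let \<xi> = (\<lambda>u \<omega>. measure (X \<omega>) (cyl (u @ [False])) / measure (X \<omega>) (cyl u))
     in prob_space.indep_vars M (\<lambda>_. borel) \<xi> UNIV \<and>
        (\<forall>u. distr M borel (\<xi> u) = uniform_measure lborel {0<..<1}))"
proof -
  interpret uniform_inputs M \<eta>
    using assms by (simp add: uniform_inputs_def uniform_inputs_axioms_def)
  have "AE \<omega> in M. weakly_converges_to (\<lambda>n. unif (bst_tree (\<lambda>i. \<eta> i \<omega>) n)) (on_vbar (X \<omega>))"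
    using AE_generic by eventually_elim (rule generic_input.trees_converge)
  note converge = this
  note gap = eventually_mono[OF AE_generic generic_input.cyl_gap]
  show ?thesis
    unfolding Let_def
    by (intro bexI[of _ X] conjI allI impI converge gap[unfolded Let_def] indep_\<xi> distr_\<xi> measurable_X)
qed

end
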